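(* Let $c\in H^2(\Omega)$ with $\partial_n c=0$ on $\partial\Omega$, set $r:=-\Delta c\in Q_0$, and let $(p,\boldsymbol u)\in Q_0\times\boldsymbol U$ be the continuous auxiliary pair associated with $r$: $$(2p+\operatorname{div}\boldsymbol u,q)=(r,q)\ \ \forall q\in Q_0,\qquad (\mathbf D\boldsymbol u,\mathbf D\boldsymbol z)+(p,\operatorname{div}\boldsymbol z)=0\ \ \forall\boldsymbol z\in\boldsymbol U.$$ Given the discrete phase field $c_h\in V_h$, let $r_h\in Q_h$ be defined by $(r_h,q_h)=(\nabla c_h,\nabla q_h)$ for all $q_h\in Q_h$, and let $(p_h,\boldsymbol u_h)\in Q_h\times\boldsymbol U_h$ be the discrete auxiliary pair with right-hand side $r_h$: $$(2p_h+\operatorname{div}\boldsymbol u_h,q_h)=(r_h,q_h)\ \ \forall q_h\in Q_h,\qquad (\mathbf D\boldsymbol u_h,\mathbf D\boldsymbol z_h)+(p_h,\operatorname{div}\boldsymbol z_h)=0\ \ \forall\boldsymbol z_h\in\boldsymbol U_h.$$ Put $\eta_{\Delta,h}:=\|r-r_h\|_{L^2(\Omega)}$. Let $$p\in H^{r_p+1}(\Omega)\cap L^2_0(\Omega),\qquad \boldsymbol u\in[H^{r_u+1}(\Omega)]^2\cap[H^1_0(\Omega)]^2.$$ Then there exists a constant $C>0$, independent of $h$, such that $$\|p-p_h\|_{L^2(\Omega)}+\|\boldsymbol u-\boldsymbol u_h\|_{H^1(\Omega)}\le C\Big(\inf_{q_h\in Q_h}\|p-q_h\|_{L^2(\Omega)}+\inf_{\boldsymbol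 z_h\in\boldsymbol U_h}\|\boldsymbol u-\boldsymbol z_h\|_{H^1(\Omega)}+\eta_{\Delta,h}\Big).$$ Consequently, $$\|p-p_h\|_{L^2(\Omega)}+\|\boldsymbol u-\boldsymbol u_h\|_{H^1(\Omega)}\le C\Big(h^{r_p+1}\|p\|_{H^{r_p+1}(\Omega)}+h^{r_u}\|\boldsymbol u\|_{H^{r_u+1}(\Omega)}+\eta_{\Delta,h}\Big).$$
   Context: $\Omega\subset\mathbb R^2$ is a bounded, connected, convex polygonal domain with outer unit normal $n$. $(\cdot,\cdot)$ is the $L^2(\Omega)$ inner product (Frobenius product for matrix fields). $Q_0:=L^2_0(\Omega)=\{q\in L^2(\Omega):\int_\Omega q\,dx=0\}$, $\boldsymbol U:=[H^1_0(\Omega)]^2$, $\mathbf D\boldsymbol v:=\frac12(\nabla\boldsymbol v+(\nabla\boldsymbol v)^T)$. $\{\mathcal T_h\}_{h>0}$ is a shape-regular family of conforming triangulations of $\Omega$, and $\mathbb V_h^k\subset H^1(\Omega)$ is the conforming Lagrange finite element space of degree $k\ge1$ on $\mathcal T_h$. For $r_c,r_p,r_u\ge1$: $V_h:=\mathbb V_h^{r_c}$, $Q_h:=\mathbb V_h^{r_p}\cap L^2_0(\Omega)$, $\boldsymbol U_h:=[\mathbb V_h^{r_u}\cap H^1_0(\Omega)]^2$. The standard approximation properties are assumed, with $C$ independent of $h$ and of the approximated function: $\inf_{q_h\in Q_h}\|q-q_h\|_{L^2(\Omega)}\le Ch^{r_p+1}\|q\|_{H^{r_p+1}(\Omega)}$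 for $q\in H^{r_p+1}(\Omega)\cap L^2_0(\Omega)$ and $\inf_{\boldsymbol z_h\in\boldsymbol U_h}\|\boldsymbol z-\boldsymbol z_h\|_{H^1(\Omega)}\le Ch^{r_u}\|\boldsymbol z\|_{H^{r_u+1}(\Omega)}$ for $\boldsymbol z\in[H^{r_u+1}(\Omega)]^2\cap[H^1_0(\Omega)]^2$. *)

theory Defs
  imports "HOL-Analysis.Analysis"
begin

text \<open>Elements of \<open>L\<^sup>2\<close> and of Sobolev spaces are represented by functions on the whole plane; only
  their values almost everywhere on the domain matter. Traces and finite element functions are
  pointwise objects on the boundary and on the closure, respectively.\<close>

section \<open>Square-integrable functions\<close>

definition L2 :: "'a measure \<Rightarrow> ('a \<Rightarrow> real) set" where
  "L2 M = {f. f \<in> borel_measurable M \<and> integrable M (\<lambda>x. (f x)\<^sup>2)}"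

definition L2norm :: "'a measure \<Rightarrow> ('a \<Rightarrow> real) \<Rightarrow> real" where
  "L2norm M f = sqrt (\<integral>x. (f x)\<^sup>2 \<partial>M)"

text \<open>The \<open>L\<^sup>2\<close> inner product on \<open>\<Omega>\<close> of scalar, vector and matrix fields. On \<^typ>\<open>real^2^2\<close> the
  library inner product is the Frobenius product.\<close>

definition L2inner :: "(real^2) set \<Rightarrow> (real^2 \<Rightarrow> 'b::real_inner) \<Rightarrow> (real^2 \<Rightarrow> 'b) \<Rightarrow> real" where
  "L2inner \<Omega> f g = (\<integral>x. f x \<bullet> g x \<partial>(lebesgue_on \<Omega>))"

definition L20 :: "(real^2) set \<Rightarrow> (real^2 \<Rightarrow> real) set" where
  "L20 \<Omega> = {q \<in> L2 (lebesgue_on \<Omega>). (\<integral>x. q x \<partial>(lebesgue_on \<Omega>)) = 0}"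

section \<open>Smooth functions, multi-indices and weak derivatives\<close>

definition pd :: "2 \<Rightarrow> (real^2 \<Rightarrow> real) \<Rightarrow> real^2 \<Rightarrow> real" where
  "pd i f x = frechet_derivative f (at x) (axis i 1)"

primrec Ck :: "nat \<Rightarrow> (real^2 \<Rightarrow> real) \<Rightarrow> bool" where
  "Ck 0 f \<longleftrightarrow> continuous_on UNIV f"
| "Ck (Suc k) f \<longleftrightarrow> (\<forall>x. f differentiable (at x)) \<and> (\<forall>i. Ck k (pd i f))"

definition smooth :: "(real^2 \<Rightarrow> real) \<Rightarrow> bool" where
  "smooth f \<longleftrightarrow> (\<forall>k. Ck k f)"

definition test_functions :: "(real^2) set \<Rightarrow> (real^2 \<Rightarrow> real) set" where
  "test_functions \<Omega> =
    {\<phi>. smooth \<phi> \<and> (\<exists>K. compact K \<and> K \<subseteq> \<Omega> \<and> (\<forall>x. x \<notin> K \<longrightarrow> \<phi> x = 0))}"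

type_synonym mindex = "2 \<Rightarrow> nat"

definition order_of :: "mindex \<Rightarrow> nat" where
  "order_of \<alpha> = (\<Sum>i\<in>UNIV. \<alpha> i)"

lemma finite_order_of_le: "finite {\<alpha>. order_of \<alpha> \<le> m}"
proof (rule finite_subset)
  show "{\<alpha>. order_of \<alpha> \<le> m} \<subseteq> {\<alpha>. range \<alpha> \<subseteq> {..m}}"
  proof safe
    fix \<alpha> :: mindex and i assume "order_of \<alpha> \<le> m"
    moreover have "\<alpha> i \<le> order_of \<alpha>"
      unfolding order_of_def by (rule member_le_sum) auto
    ultimately show "\<alpha> i \<le> m" by simp
  qed
  have "{\<alpha> :: mindex. range \<alpha> \<subseteq> {..m}} = (\<Pi>\<^sub>E i\<in>UNIV. {..m})"
    by (auto simp: PiE_UNIV_domain)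
  then show "finite {\<alpha> :: mindex. range \<alpha> \<subseteq> {..m}}"
    by (simp add: finite_PiE)
qed

definition mpd :: "mindex \<Rightarrow> (real^2 \<Rightarrow> real) \<Rightarrow> real^2 \<Rightarrow> real" where
  "mpd \<alpha> f = (pd 1 ^^ \<alpha> 1) ((pd 2 ^^ \<alpha> 2) f)"

definition has_weak_deriv ::
    "(real^2) set \<Rightarrow> mindex \<Rightarrow> (real^2 \<Rightarrow> real) \<Rightarrow> (real^2 \<Rightarrow> real) \<Rightarrow> bool" where
  "has_weak_deriv \<Omega> \<alpha> f g \<longleftrightarrow> g \<in> L2 (lebesgue_on \<Omega>) \<and>
    (\<forall>\<phi>\<in>test_functions \<Omega>. (\<integral>x. f x * mpd \<alpha> \<phi> x \<partial>(lebesgue_on \<Omega>))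
        = (-1) ^ order_of \<alpha> * (\<integral>x. g x * \<phi> x \<partial>(lebesgue_on \<Omega>)))"

text \<open>A representative of the weak derivative, which is unique up to null sets; meaningless if
  no square-integrable weak derivative exists.\<close>

definition wderiv :: "(real^2) set \<Rightarrow> mindex \<Rightarrow> (real^2 \<Rightarrow> real) \<Rightarrow> real^2 \<Rightarrow> real" where
  "wderiv \<Omega> \<alpha> f = (SOME g. has_weak_deriv \<Omega> \<alpha> f g)"

definition wpd :: "(real^2) set \<Rightarrow> 2 \<Rightarrow> (real^2 \<Rightarrow> real) \<Rightarrow> real^2 \<Rightarrow> real" where
  "wpd \<Omega> i f = wderiv \<Omega> (\<lambda>j. if j = i then 1 else 0) f"

definition wgrad :: "(real^2) set \<Rightarrow> (real^2 \<Rightarrow> real) \<Rightarrow> real^2 \<Rightarrow> real^2" where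
  "wgrad \<Omega> f x = (\<chi> i. wpd \<Omega> i f x)"

definition wlaplace :: "(real^2) set \<Rightarrow> (real^2 \<Rightarrow> real) \<Rightarrow> real^2 \<Rightarrow> real" where
  "wlaplace \<Omega> f x = (\<Sum>i\<in>UNIV. wderiv \<Omega> (\<lambda>j. if j = i then 2 else 0) f x)"

definition wdiv :: "(real^2) set \<Rightarrow> (real^2 \<Rightarrow> real^2) \<Rightarrow> real^2 \<Rightarrow> real" where
  "wdiv \<Omega> v x = (\<Sum>i\<in>UNIV. wpd \<Omega> i (\<lambda>y. v y $ i) x)"

definition wjacobian :: "(real^2) set \<Rightarrow> (real^2 \<Rightarrow> real^2) \<Rightarrow> real^2 \<Rightarrow> real^2^2" where
  "wjacobian \<Omega> v x = (\<chi> i j. wpd \<Omega> j (\<lambda>y. v y $ i) x)"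

definition symgrad :: "(real^2) set \<Rightarrow> (real^2 \<Rightarrow> real^2) \<Rightarrow> real^2 \<Rightarrow> real^2^2" where
  "symgrad \<Omega> v x = (1/2) *\<^sub>R (wjacobian \<Omega> v x + transpose (wjacobian \<Omega> v x))"

section \<open>Sobolev spaces\<close>

definition Hspace :: "(real^2) set \<Rightarrow> nat \<Rightarrow> (real^2 \<Rightarrow> real) set" where
  "Hspace \<Omega> m =
    {f \<in> L2 (lebesgue_on \<Omega>). \<forall>\<alpha>. order_of \<alpha> \<le> m \<longrightarrow> (\<exists>g. has_weak_deriv \<Omega> \<alpha> f g)}"

definition Hnorm :: "(real^2) set \<Rightarrow> nat \<Rightarrow> (real^2 \<Rightarrow> real) \<Rightarrow> real" where
  "Hnorm \<Omega> m f = sqrt (\<Sum>\<alpha> | order_of \<alpha> \<le> m. (L2norm (lebesgue_on \<Omega>) (wderiv \<Omega> \<alpha> f))\<^sup>2)"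

definition H10 :: "(real^2) set \<Rightarrow> (real^2 \<Rightarrow> real) set" where
  "H10 \<Omega> =
    {f \<in> Hspace \<Omega> 1. \<forall>\<epsilon>>0. \<exists>\<phi>\<in>test_functions \<Omega>. Hnorm \<Omega> 1 (\<lambda>x. f x - \<phi> x) < \<epsilon>}"

text \<open>The space \<open>[S]\<^sup>2\<close> of vector fields with components in \<open>S\<close>.\<close>

definition vec_space :: "(real^2 \<Rightarrow> real) set \<Rightarrow> (real^2 \<Rightarrow> real^2) set" where
  "vec_space S = {v. \<forall>i. (\<lambda>x. v x $ i) \<in> S}"

definition vHnorm :: "(real^2) set \<Rightarrow> nat \<Rightarrow> (real^2 \<Rightarrow> real^2) \<Rightarrow> real" where
  "vHnorm \<Omega> m v = sqrt (\<Sum>i\<in>UNIV. (Hnorm \<Omega> m (\<lambda>x. v x $ i))\<^sup>2)"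

section \<open>The domain, traces and the Neumann condition\<close>

definition convex_polygonal_domain :: "(real^2) set \<Rightarrow> bool" where
  "convex_polygonal_domain \<Omega> \<longleftrightarrow> open \<Omega> \<and> \<Omega> \<noteq> {} \<and> bounded \<Omega> \<and> connected \<Omega> \<and> convex \<Omega> \<and>
     polytope (closure \<Omega>)"

definition is_edge :: "(real^2) set \<Rightarrow> real^2 \<Rightarrow> real^2 \<Rightarrow> bool" where
  "is_edge \<Omega> a b \<longleftrightarrow> closed_segment a b facet_of closure \<Omega>"

definition outer_unit_normal :: "(real^2) set \<Rightarrow> real^2 \<Rightarrow> real^2 \<Rightarrow> real^2 \<Rightarrow> bool" where
  "outer_unit_normal \<Omega> a b \<nu> \<longleftrightarrow> norm \<nu> = 1 \<and> \<nu> \<bullet> (b - a) = 0 \<and> (\<forall>x\<in>\<Omega>. \<nu> \<bullet> (x - a) < 0)"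

text \<open>\<open>g\<close> is the boundary trace of \<open>f \<in> H\<^sup>1(\<Omega>)\<close>: the limit in \<open>L\<^sup>2(\<partial>\<Omega>)\<close> of the boundary values of
  smooth functions converging to \<open>f\<close> in \<open>H\<^sup>1(\<Omega>)\<close>. The boundary is the finite union of the edges, and
  on each edge arc length is a constant multiple of the parameter of \<^const>\<open>linepath\<close>.\<close>

definition has_trace :: "(real^2) set \<Rightarrow> (real^2 \<Rightarrow> real) \<Rightarrow> (real^2 \<Rightarrow> real) \<Rightarrow> bool" where
  "has_trace \<Omega> f g \<longleftrightarrow> f \<in> Hspace \<Omega> 1 \<and>
    (\<forall>a b. is_edge \<Omega> a b \<longrightarrow> g \<circ> linepath a b \<in> L2 (lebesgue_on {0..1})) \<and>
    (\<exists>\<phi> :: nat \<Rightarrow> real^2 \<Rightarrow> real. (\<forall>k. smooth (\<phi> k)) \<and>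
       (\<lambda>k. Hnorm \<Omega> 1 (\<lambda>x. \<phi> k x - f x)) \<longlonglongrightarrow> 0 \<and>
       (\<forall>a b. is_edge \<Omega> a b \<longrightarrow>
          (\<lambda>k. L2norm (lebesgue_on {0..1}) ((\<lambda>x. \<phi> k x - g x) \<circ> linepath a b)) \<longlonglongrightarrow> 0))"

text \<open>\<open>\<partial>\<^sub>n c = 0\<close> almost everywhere on the boundary, where \<open>\<partial>\<^sub>n c = n \<bullet> G\<close> with \<open>G\<close> the trace of
  the gradient of \<open>c \<in> H\<^sup>2(\<Omega>)\<close>.\<close>

definition zero_normal_deriv :: "(real^2) set \<Rightarrow> (real^2 \<Rightarrow> real) \<Rightarrow> bool" where
  "zero_normal_deriv \<Omega> c \<longleftrightarrow>
    (\<exists>G :: real^2 \<Rightarrow> real^2. (\<forall>i. has_trace \<Omega> (wpd \<Omega> i c) (\<lambda>x. G x $ i)) \<and>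
       (\<forall>a b \<nu>. is_edge \<Omega> a b \<and> outer_unit_normal \<Omega> a b \<nu> \<longrightarrow>
          (AE t in lebesgue_on {0..1}. \<nu> \<bullet> G (linepath a b t) = 0)))"

section \<open>Triangulations and Lagrange finite elements\<close>

definition conforming_triangulation :: "(real^2) set \<Rightarrow> (real^2) set set \<Rightarrow> bool" where
  "conforming_triangulation \<Omega> \<T> \<longleftrightarrow>
     triangulation \<T> \<and> (\<forall>K\<in>\<T>. 2 simplex K) \<and> \<Union>\<T> = closure \<Omega>"

definition shape_regular_family :: "real set \<Rightarrow> (real \<Rightarrow> (real^2) set set) \<Rightarrow> bool" where
  "shape_regular_family H \<T> \<longleftrightarrow>
     (\<exists>\<kappa>>0. \<forall>h\<in>H. \<forall>K\<in>\<T> h. \<exists>x \<rho>. \<rho> > 0 \<and> cball x \<rho> \<subseteq> K \<and> diameter K \<le> \<kappa> * \<rho>)"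

text \<open>The index \<open>h\<close> bounds the mesh size. The index set \<open>H\<close> may be all positive reals, a sequence
  tending to 0, or the set of the exact mesh sizes that occur.\<close>

definition mesh_family :: "(real^2) set \<Rightarrow> real set \<Rightarrow> (real \<Rightarrow> (real^2) set set) \<Rightarrow> bool" where
  "mesh_family \<Omega> H \<T> \<longleftrightarrow> H \<subseteq> {0<..} \<and>
     (\<forall>h\<in>H. conforming_triangulation \<Omega> (\<T> h) \<and> (\<forall>K\<in>\<T> h. diameter K \<le> h)) \<and>
     shape_regular_family H \<T>"

definition polynomial_on :: "nat \<Rightarrow> (real^2) set \<Rightarrow> (real^2 \<Rightarrow> real) \<Rightarrow> bool" where
  "polynomial_on k K v \<longleftrightarrow>
    (\<exists>a :: mindex \<Rightarrow> real. \<forall>x\<in>K. v x = (\<Sum>\<alpha> | order_of \<alpha> \<le> k. a \<alpha> * (\<Prod>i\<in>UNIV. (x $ i) ^ \<alpha> i)))"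

definition Lagrange :: "(real^2) set \<Rightarrow> (real^2) set set \<Rightarrow> nat \<Rightarrow> (real^2 \<Rightarrow> real) set" where
  "Lagrange \<Omega> \<T> k = {v. continuous_on (closure \<Omega>) v \<and> (\<forall>K\<in>\<T>. polynomial_on k K v)}"

definition Qh :: "(real^2) set \<Rightarrow> (real^2) set set \<Rightarrow> nat \<Rightarrow> (real^2 \<Rightarrow> real) set" where
  "Qh \<Omega> \<T> k = Lagrange \<Omega> \<T> k \<inter> L20 \<Omega>"

definition Uh :: "(real^2) set \<Rightarrow> (real^2) set set \<Rightarrow> nat \<Rightarrow> (real^2 \<Rightarrow> real^2) set" where
  "Uh \<Omega> \<T> k = vec_space (Lagrange \<Omega> \<T> k \<inter> H10 \<Omega>)"

definition best_p ::
    "(real^2) set \<Rightarrow> (real^2 \<Rightarrow> real) set \<Rightarrow> (real^2 \<Rightarrow> real) \<Rightarrow> real" where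
  "best_p \<Omega> Q p = (INF q\<in>Q. L2norm (lebesgue_on \<Omega>) (\<lambda>x. p x - q x))"

definition best_u ::
    "(real^2) set \<Rightarrow> (real^2 \<Rightarrow> real^2) set \<Rightarrow> (real^2 \<Rightarrow> real^2) \<Rightarrow> real" where
  "best_u \<Omega> U u = (INF z\<in>U. vHnorm \<Omega> 1 (\<lambda>x. u x - z x))"

section \<open>The auxiliary problem\<close>

text \<open>One definition for the continuous problem and, with finite element spaces \<open>Q\<close> and \<open>U\<close>, for the
  discrete one.\<close>

definition auxiliary_pair ::
    "(real^2) set \<Rightarrow> (real^2 \<Rightarrow> real) set \<Rightarrow> (real^2 \<Rightarrow> real^2) set \<Rightarrow> (real^2 \<Rightarrow> real) \<Rightarrow>
     (real^2 \<Rightarrow> real) \<Rightarrow> (real^2 \<Rightarrow> real^2) \<Rightarrow> bool" where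
  "auxiliary_pair \<Omega> Q U r p u \<longleftrightarrow> p \<in> Q \<and> u \<in> U \<and>
    (\<forall>q\<in>Q. L2inner \<Omega> (\<lambda>x. 2 * p x + wdiv \<Omega> u x) q = L2inner \<Omega> r q) \<and>
    (\<forall>z\<in>U. L2inner \<Omega> (symgrad \<Omega> u) (symgrad \<Omega> z) + L2inner \<Omega> p (wdiv \<Omega> z) = 0)"

definition discrete_neg_laplacian ::
    "(real^2) set \<Rightarrow> (real^2 \<Rightarrow> real) set \<Rightarrow> (real^2 \<Rightarrow> real) \<Rightarrow> (real^2 \<Rightarrow> real) \<Rightarrow> bool" where
  "discrete_neg_laplacian \<Omega> Q ch rh \<longleftrightarrow> rh \<in> Q \<and>
    (\<forall>q\<in>Q. L2inner \<Omega> rh q = L2inner \<Omega> (wgrad \<Omega> ch) (wgrad \<Omega> q))"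

end

theory Submission
  imports Defs
begin

text \<open>Testing the auxiliary problem with \<open>(q, z) = (p, u)\<close> gives the form
  \<open>2\<parallel>p\<parallel>\<^sup>2 + 2(p, div u) + \<parallel>D u\<parallel>\<^sup>2\<close>. By Korn's identity, which rests on
  \<open>\<integral>\<partial>\<^sub>2 f \<partial>\<^sub>1 g = \<integral>\<partial>\<^sub>1 f \<partial>\<^sub>2 g\<close> for \<open>f \<in> H\<^sup>1\<close>, \<open>g \<in> H\<^sup>1\<^sub>0\<close>, and Poincare's
  inequality it is coercive on all of \<open>L\<^sup>2 \<times> [H\<^sup>1\<^sub>0]\<^sup>2\<close>, with a constant depending only on the size of \<open>\<Omega>\<close>. No inf-sup
  condition is therefore needed, and quasi-optimality follows as in Cea's lemma, the perturbation
  of the right-hand side contributing \<open>\<parallel>r - r\<^sub>h\<parallel>\<close>.\<close>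

section \<open>Calculus of smooth functions\<close>

text \<open>Pointwise the form degenerates: with a matrix a in place of the gradient, 2 w^2 + 2 w tr
  a + |sym a|^2 vanishes when a is t times the identity plus an antisymmetric matrix and w = -t.
  Coercivity is therefore a property of the integral, and the exchange of derivatives for
  \<open>H10\<close> fields is what removes this kernel. It rests on the symmetry of second
  derivatives of test functions. A second obstacle is that weak derivatives are chosen
  representatives, so that even the derivative of a difference is known only almost everywhere. This
  calls for uniqueness of weak derivatives, hence for the fundamental lemma of the calculus of
  variations, hence for explicit bump functions. Estimates are made pointwise for squares and then
  integrated; the passage from squared norms back to norms happens once, at the end.\<close>

lemma pd_eqI: "(f has_derivative D) (at x) \<Longrightarrow> pd i f x = D (axis i 1)"
  unfolding pd_def by (metis frechet_derivative_at)

lemma Ck_continuous: "Ck k f \<Longrightarrow> continuous_on UNIV f"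
  by (cases k) (simp_all add: differentiable_imp_continuous_on differentiable_on_def)

lemma Ck_Suc_imp: "Ck (Suc k) f \<Longrightarrow> Ck k f"
proof (induction k arbitrary: f)
  case 0
  then show ?case using Ck_continuous[of "Suc 0" f] by simp
qed auto

lemma pd_const: "pd i (\<lambda>x. c) = (\<lambda>x. 0)"
  by (auto intro: pd_eqI[OF has_derivative_const])

lemma Ck_const [simp]: "Ck k (\<lambda>x. c)"
  by (induction k arbitrary: c) (auto simp: pd_const)

lemma pd_add:
  "f differentiable (at x) \<Longrightarrow> g differentiable (at x) \<Longrightarrow>
    pd i (\<lambda>x. f x + g x) x = pd i f x + pd i g x"
  unfolding frechet_derivative_works pd_def[of i f] pd_def[of i g]
  by (rule pd_eqI) (rule has_derivative_add)

lemma pd_mult: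
  "f differentiable (at x) \<Longrightarrow> g differentiable (at x) \<Longrightarrow>
    pd i (\<lambda>x. f x * g x) x = pd i f x * g x + f x * pd i g x"
  unfolding frechet_derivative_works pd_def[of i f] pd_def[of i g]
  by (subst pd_eqI[OF has_derivative_mult]) auto

lemma Ck_add: "Ck k f \<Longrightarrow> Ck k g \<Longrightarrow> Ck k (\<lambda>x. f x + g x)"
proof (induction k arbitrary: f g)
  case (Suc k)
  then have "pd i (\<lambda>x. f x + g x) = (\<lambda>x. pd i f x + pd i g x)" for i
    by (auto intro!: pd_add)
  with Suc show ?case by auto
qed (simp_all add: continuous_on_add continuous_on_mult)

lemma Ck_mult: "Ck k f \<Longrightarrow> Ck k g \<Longrightarrow> Ck k (\<lambda>x. f x * g x)"
proof (induction k arbitrary: f g)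
  case (Suc k)
  then have "pd i (\<lambda>x. f x * g x) = (\<lambda>x. pd i f x * g x + f x * pd i g x)" for i
    by (auto intro!: pd_mult)
  moreover have "Ck k f" "Ck k g" using Suc.prems Ck_Suc_imp by auto
  ultimately show ?case using Suc by (auto intro!: Ck_add)
qed (simp_all add: continuous_on_add continuous_on_mult)

lemma smooth_pd: "smooth f \<Longrightarrow> smooth (pd i f)"
  unfolding smooth_def by (metis Ck.simps(2))

lemma smooth_differentiable: "smooth f \<Longrightarrow> f differentiable (at x)"
  unfolding smooth_def by (metis Ck.simps(2))

lemma smooth_continuous: "smooth f \<Longrightarrow> continuous_on S f"
  unfolding smooth_def by (metis Ck_continuous continuous_on_subset top_greatest)

lemma smooth_mult: "smooth f \<Longrightarrow> smooth g \<Longrightarrow> smooth (\<lambda>x. f x * g x)"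
  unfolding smooth_def by (simp add: Ck_mult)

lemma smooth_add: "smooth f \<Longrightarrow> smooth g \<Longrightarrow> smooth (\<lambda>x. f x + g x)"
  unfolding smooth_def by (simp add: Ck_add)

lemma smooth_const: "smooth (\<lambda>x. c)"
  unfolding smooth_def by simp

lemma pd_coord: "pd i (\<lambda>x. x $ j) = (\<lambda>x. if i = j then 1 else 0)"
proof
  fix x :: "real^2"
  have "((\<lambda>x. x $ j) has_derivative (\<lambda>x. x $ j)) (at x)"
    by (intro bounded_linear_imp_has_derivative bounded_linear_vec_nth)
  from pd_eqI[OF this, of i] show "pd i (\<lambda>x. x $ j) x = (if i = j then 1 else 0)"
    by (auto simp: axis_def)
qed

lemma smooth_coord: "smooth (\<lambda>x. x $ j)"
  unfolding smooth_def
proof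
  fix k
  have d: "(\<lambda>x::real^2. x $ j) differentiable (at x)" for x
    by (intro bounded_linear_imp_differentiable bounded_linear_vec_nth)
  show "Ck k (\<lambda>x. x $ j)"
    by (cases k) (auto intro: continuous_on_component continuous_on_id simp: pd_coord d)
qed

text \<open>Along a coordinate line a partial derivative is an ordinary one. This gives access to
  the mean value theorem, the fundamental theorem of calculus and the Leibniz rule.\<close>

lemma pd_has_field_derivative_line:
  assumes "\<And>y. f differentiable (at y)"
  shows "((\<lambda>t. f (x + t *\<^sub>R axis i 1)) has_field_derivative pd i f (x + t *\<^sub>R axis i 1)) (at t)"
proof -
  have 1: "(f has_derivative frechet_derivative f (at (x + t *\<^sub>R axis i 1))) (at (x + t *\<^sub>R axis i 1))"
    using assms frechet_derivative_works by blast
  have 2: "((\<lambda>t. x + t *\<^sub>R axis i 1) has_derivative (\<lambda>s. s *\<^sub>R axis i 1)) (at t)"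
    by (auto intro!: derivative_eq_intros)
  have lin: "linear (frechet_derivative f (at (x + t *\<^sub>R axis i 1)))"
    using assms linear_frechet_derivative by blast
  show ?thesis
    unfolding has_field_derivative_def
    by (rule has_derivative_eq_rhs[OF diff_chain_at[OF 2 1, unfolded o_def]])
       (simp add: fun_eq_iff pd_def linear_cmul[OF lin])
qed

text \<open>Differentiate \<open>f (x + s e\<^sub>i + t e\<^sub>j) - f (x + s e\<^sub>i) = \<integral>\<^sub>0\<^sup>t \<partial>\<^sub>j f (x + s e\<^sub>i + \<tau> e\<^sub>j) d\<tau>\<close> under the integral sign
  in \<open>s\<close>, then in \<open>t\<close>.\<close>

lemma pd_commute:
  assumes "smooth f"
  shows "pd i (pd j f) = pd j (pd i f)"
proof
  fix x :: "real^2"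
  let ?z = "\<lambda>s t. x + s *\<^sub>R axis i 1 + t *\<^sub>R axis j (1::real)"
  note df = smooth_differentiable[OF assms] smooth_differentiable[OF smooth_pd[OF assms]]
  have D: "((\<lambda>s. integral (cbox 0 t) (\<lambda>t. pd j f (?z s t))) has_field_derivative
      integral (cbox 0 t) (\<lambda>t. pd i (pd j f) (?z 0 t))) (at 0)" for t :: real
  proof -
    have der: "((\<lambda>s. pd j f (?z s t)) has_field_derivative pd i (pd j f) (?z s t)) (at s)" for s t
      using pd_has_field_derivative_line[OF df(2), of j "x + t *\<^sub>R axis j 1" i s] by (simp add: algebra_simps)
    have cont: "continuous_on S (pd i (pd j f))" "continuous_on S (pd j f)" for S
      by (auto intro!: smooth_continuous smooth_pd assms)
    have ci: "continuous_on S (\<lambda>t. pd j f (?z s t))" for S s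
      by (rule continuous_on_compose2[OF cont(2)[of UNIV]]) (auto intro!: continuous_intros)
    have cm: "continuous_on S (\<lambda>(s, t). pd i (pd j f) (?z s t))" for S
      unfolding split_beta
      by (rule continuous_on_compose2[OF cont(1)[of UNIV]]) (auto intro!: continuous_intros)
    show ?thesis
      by (rule leibniz_rule_field_derivative[where U=UNIV and fx="\<lambda>s t. pd i (pd j f) (?z s t)", OF der _ cm])
         (simp_all add: integrable_continuous_real[OF ci])
  qed
  have ftc: "integral (cbox 0 t) (\<lambda>t. pd j f (?z s t)) = f (?z s t) - f (?z s 0)" if "t \<ge> 0" for s t
  proof (rule integral_unique)
    have "((\<lambda>t. f (?z s t)) has_field_derivative pd j f (?z s t)) (at t)" for t
      using pd_has_field_derivative_line[OF df(1), of "x + s *\<^sub>R axis i 1" j t] by (simp add: algebra_simps)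
    then show "((\<lambda>t. pd j f (?z s t)) has_integral f (?z s t) - f (?z s 0)) (cbox 0 t)"
      unfolding interval_cbox[symmetric] using that
      by (intro fundamental_theorem_of_calculus)
         (auto simp flip: has_real_derivative_iff_has_vector_derivative intro: has_field_derivative_at_within)
  qed
  \<comment> \<open>Two values for one derivative at \<open>s = 0\<close>: \<open>D\<close>
    differentiates under the integral sign, \<open>ftc\<close> evaluates the integral first.\<close>
  have eq: "integral (cbox 0 t) (\<lambda>t. pd i (pd j f) (?z 0 t)) = pd i f (?z 0 t) - pd i f x" if "t \<ge> 0" for t
  proof (rule DERIV_unique[OF D])
    have "((\<lambda>s. f (?z s t)) has_field_derivative pd i f (?z 0 t)) (at 0)" for t
      using pd_has_field_derivative_line[OF df(1), of "x + t *\<^sub>R axis j 1" i 0] by (simp add: algebra_simps)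
    from DERIV_diff[OF this[of t] this[of 0]]
    show "((\<lambda>s. integral (cbox 0 t) (\<lambda>t. pd j f (?z s t))) has_field_derivative
        pd i f (?z 0 t) - pd i f x) (at 0)"
      unfolding ftc[OF that] by simp
  qed
  \<comment> \<open>Since \<open>eq\<close> is known for nonnegative \<open>t\<close> only, the
    derivative at 0 is taken within \<open>{0..1}\<close>. It is still unique, as 0 is a limit point
    of this interval.\<close>
  have "((\<lambda>u. integral {0..u} (\<lambda>t. pd i (pd j f) (?z 0 t))) has_field_derivative
      pd i (pd j f) (?z 0 0)) (at 0 within {0..1})"
    by (intro integral_has_real_derivative continuous_on_compose2[OF smooth_continuous[OF smooth_pd[OF smooth_pd[OF assms]], of UNIV]])
       (auto intro!: continuous_intros)
  then have 1: "((\<lambda>t. pd i f (?z 0 t) - pd i f x) has_field_derivative pd i (pd j f) (?z 0 0)) (at 0 within {0..1})"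
    by (rule has_field_derivative_transform_within[where d=1])
       (use eq[unfolded cbox_interval] in auto)
  have 2: "((\<lambda>t. pd i f (?z 0 t) - pd i f x) has_field_derivative pd j (pd i f) x) (at 0 within {0..1})"
    using DERIV_diff[OF pd_has_field_derivative_line[OF df(2), of i x j 0] DERIV_const[of "pd i f x"]]
    by (auto intro: has_field_derivative_at_within)
  have 3: "at (0::real) within {0..1} \<noteq> bot"
    using islimpt_Icc[of 0 1 "0::real"] by (simp add: trivial_limit_within[of 0 "{0..1::real}"])
  show "pd i (pd j f) x = pd j (pd i f) x"
    using has_field_derivative_unique[OF 1 2 3] by simp
qed

section \<open>Bump functions\<close>

text \<open>The powers of \<open>1 / t\<close> make the span of the family closed under differentiation.\<close>

definition flat :: "nat \<Rightarrow> real \<Rightarrow> real" where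
  "flat n t = (if t > 0 then exp (- inverse t) * inverse t ^ n else 0)"

text \<open>In the variable \<open>inverse t\<close> this is the decay of a power against the
  exponential; on the left the function is 0.\<close>

lemma flat_tendsto_0: "(flat n \<longlongrightarrow> 0) (at 0)"
proof -
  have "((\<lambda>t. inverse t ^ n / exp (inverse t)) \<longlongrightarrow> 0) (at_right (0::real))"
    by (rule filterlim_compose[OF tendsto_power_div_exp_0 filterlim_inverse_at_top_right])
  then have "(flat n \<longlongrightarrow> 0) (at_right 0)"
    by (rule Lim_transform_eventually)
       (auto simp: flat_def exp_minus field_simps eventually_at_filter)
  moreover have "(flat n \<longlongrightarrow> 0) (at_left 0)"
    by (rule Lim_transform_eventually[OF tendsto_const])
       (auto simp: flat_def eventually_at_filter)
  ultimately show ?thesis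
    using filterlim_split_at by blast
qed

lemma flat_has_derivative:
  "(flat n has_field_derivative flat (n + 2) t - real n * flat (n + 1) t) (at t)"
proof (cases t "0::real" rule: linorder_cases)
  case less
  then have "(flat n has_field_derivative 0) (at t)"
    by (intro has_field_derivative_transform_within_open[OF DERIV_const[of 0], of "{..<0}"])
       (auto simp: flat_def)
  with less show ?thesis by (simp add: flat_def)
next
  case equal
  \<comment> \<open>Dividing by \<open>h\<close> raises the power by one, so the difference quotient
    of \<open>flat n\<close> at 0 is \<open>flat (n + 1)\<close>.\<close>
  have "((\<lambda>h. (flat n (0 + h) - flat n 0) / h) \<longlongrightarrow> 0) (at 0)"
    by (rule Lim_transform_eventually[OF flat_tendsto_0[of "n + 1"]])
       (auto simp: flat_def field_simps eventually_at_filter)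
  then show ?thesis
    using equal by (simp add: DERIV_def flat_def)
next
  case greater
  \<comment> \<open>The power rule produces the truncated exponent \<open>n - 1\<close>; for
    \<open>n = 0\<close> both sides vanish.\<close>
  have p: "real n * inverse t ^ (n - 1) * inverse t = real n * inverse t ^ n"
    by (cases n) auto
  have "((\<lambda>t. exp (- inverse t) * inverse t ^ n) has_field_derivative
      exp (- inverse t) * inverse t ^ (n + 2)
        - exp (- inverse t) * (real n * inverse t ^ (n - 1) * inverse t) * inverse t) (at t)"
    using greater by (auto intro!: derivative_eq_intros simp: algebra_simps power2_eq_square)
  then have "((\<lambda>t. exp (- inverse t) * inverse t ^ n) has_field_derivative
      flat (n + 2) t - real n * flat (n + 1) t) (at t)"
    unfolding p using greater by (simp add: flat_def mult_ac)
  then show ?thesis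
    by (rule has_field_derivative_transform_within_open[of _ _ _ "{0<..}"])
       (use greater in \<open>auto simp: flat_def\<close>)
qed

text \<open>Induction on the order for all \<open>n\<close> at once, as each derivative combines two
  further members of the family. The sign of \<open>d\<close> decides on which side the function is
  cut off, so that two such factors confine a coordinate to an interval.\<close>

lemma smooth_flat: "smooth (\<lambda>x. flat n (c + d * x $ j))"
  unfolding smooth_def
proof
  fix k
  have D: "((\<lambda>x. flat n (c + d * x $ j)) has_derivative
      (\<lambda>y. (flat (n + 2) (c + d * x $ j) - real n * flat (n + 1) (c + d * x $ j)) * (d * y $ j))) (at x)"
    for n and x :: "real^2"
  proof -
    have "((\<lambda>x. c + d * x $ j) has_derivative (\<lambda>y. d * y $ j)) (at x)"
      using bounded_linear_imp_has_derivative[OF bounded_linear_vec_nth[of j], of "at x"]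
      by (auto intro!: derivative_eq_intros)
    from has_derivative_compose[OF this flat_has_derivative[THEN has_field_derivative_imp_has_derivative]]
    show ?thesis .
  qed
  have P: "pd i (\<lambda>x. flat n (c + d * x $ j)) =
      (\<lambda>x. (flat (n + 2) (c + d * x $ j) + (- real n) * flat (n + 1) (c + d * x $ j))
        * (if i = j then d else 0))" for n i
    by (rule ext, subst pd_eqI[OF D]) (auto simp: axis_def)
  show "Ck k (\<lambda>x. flat n (c + d * x $ j))"
  proof (induction k arbitrary: n)
    case 0
    have "(\<lambda>x. flat n (c + d * x $ j)) differentiable at x" for x
      using D differentiable_def by blast
    then show ?case by (simp add: differentiable_imp_continuous_on differentiable_on_def)
  next
    case (Suc k)
    have "(\<lambda>x. flat n (c + d * x $ j)) differentiable at x" for x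
      using D differentiable_def by blast
    moreover have "Ck k (pd i (\<lambda>x. flat n (c + d * x $ j)))" for i
      unfolding P by (intro Ck_mult Ck_add Ck_const Suc.IH)
    ultimately show ?case by simp
  qed
qed

text \<open>Four one-sided cutoffs multiplied together. The factor \<open>Suc k\<close> steepens
  them: for positive argument \<open>flat 0\<close> is \<open>exp (- inverse t)\<close>, which tends
  to 1 as \<open>t\<close> grows. Every member vanishes off the open box, so its support stays in
  the closed one.\<close>

lemma box_bump_approximation:
  fixes a b :: "real^2"
  obtains \<psi> :: "nat \<Rightarrow> real^2 \<Rightarrow> real"
  where "\<And>k. smooth (\<psi> k)" "\<And>k x. 0 \<le> \<psi> k x \<and> \<psi> k x \<le> indicator (box a b) x"
    "\<And>x. (\<lambda>k. \<psi> k x) \<longlonglongrightarrow> indicator (box a b) x"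
proof
  let ?\<phi> = "\<lambda>k i x. flat 0 ((- real (Suc k) * a $ i) + real (Suc k) * x $ i)
    * flat 0 ((real (Suc k) * b $ i) + (- real (Suc k)) * x $ i)"
  let ?\<psi> = "\<lambda>k x. ?\<phi> k 1 x * ?\<phi> k 2 x"
  have arg: "(- real (Suc k) * a $ i) + real (Suc k) * x $ i = real (Suc k) * (x $ i - a $ i)"
    "(real (Suc k) * b $ i) + (- real (Suc k)) * x $ i = real (Suc k) * (b $ i - x $ i)" for k i and x :: "real^2"
    by (simp_all add: algebra_simps)
  have box: "x \<in> box a b \<longleftrightarrow> a $ 1 < x $ 1 \<and> x $ 1 < b $ 1 \<and> a $ 2 < x $ 2 \<and> x $ 2 < b $ 2" for x
    by (auto simp: mem_box_cart forall_2)
  have flat0: "0 \<le> flat 0 t" "flat 0 t \<le> 1" "t \<le> 0 \<Longrightarrow> flat 0 t = 0" for t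
    by (auto simp: flat_def)
  have pos: "0 < real (Suc k) * t \<longleftrightarrow> 0 < t" for k t
    by (simp add: zero_less_mult_iff)
  have lim: "(\<lambda>k. flat 0 (real (Suc k) * t)) \<longlonglongrightarrow> (if 0 < t then 1 else 0)" for t
  proof (cases "0 < t")
    case True
    have "(\<lambda>k. exp (- (inverse t * inverse (real (Suc k))))) \<longlonglongrightarrow> exp (- (inverse t * 0))"
      by (intro tendsto_intros LIMSEQ_inverse_real_of_nat)
    with True show ?thesis
      by (simp add: flat_def pos inverse_mult_distrib mult.commute del: of_nat_Suc)
  next
    case False
    then show ?thesis by (simp add: flat_def pos del: of_nat_Suc)
  qed
  show "smooth (?\<psi> k)" for k
    by (intro smooth_mult smooth_flat)
  show "0 \<le> ?\<psi> k x \<and> ?\<psi> k x \<le> indicator (box a b) x" for k x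
  proof (cases "x \<in> box a b")
    case True
    then show ?thesis
      by (auto intro!: mult_le_one mult_nonneg_nonneg flat0)
  next
    case False
    then have 0: "?\<psi> k x = 0"
      unfolding arg box by (auto simp: flat_def zero_less_mult_iff)
    show ?thesis unfolding 0 by simp
  qed
  have "(\<lambda>k. ?\<psi> k x) \<longlonglongrightarrow> ((if 0 < x $ 1 - a $ 1 then 1 else 0) * (if 0 < b $ 1 - x $ 1 then 1 else 0))
      * ((if 0 < x $ 2 - a $ 2 then 1 else 0) * (if 0 < b $ 2 - x $ 2 then 1 else 0))" for x
    unfolding arg by (intro tendsto_mult lim)
  moreover have "((if 0 < x $ 1 - a $ 1 then 1 else 0) * (if 0 < b $ 1 - x $ 1 then 1 else 0))
      * ((if 0 < x $ 2 - a $ 2 then 1 else 0) * (if 0 < b $ 2 - x $ 2 then 1 else 0)) =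
      (indicator (box a b) x :: real)" for x
    by (auto simp: indicator_def box)
  ultimately show "(\<lambda>k. ?\<psi> k x) \<longlonglongrightarrow> indicator (box a b) x" for x
    by simp
qed

text \<open>The Borel sets over which \<open>g\<close> integrates to 0 form a Dynkin system, and the
  open boxes are an intersection-stable generator. Hence \<open>g\<close> and 0 have the same
  integral over every Borel set.\<close>

lemma AE_eq_0_if_box_integrals_0:
  fixes g :: "'a::euclidean_space \<Rightarrow> real"
  assumes g: "integrable lborel g"
    and box: "\<And>a b. (\<integral>x. indicator (box a b) x * g x \<partial>lborel) = 0"
  shows "AE x in lborel. g x = 0"
proof (rule density_unique_real[OF g])
  show "integrable lborel (\<lambda>_. 0 :: real)" by simp
  have [measurable]: "g \<in> borel_measurable borel"
    using g by auto
  have int: "integrable lborel (\<lambda>x. indicator A x * g x)" if "A \<in> sets borel" for A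
    using integrable_mult_indicator[OF _ g, of A] that by simp
  fix A :: "'a set" assume "A \<in> sets lborel"
  then have "A \<in> sigma_sets UNIV (range (\<lambda>(a, b). box a b))"
    unfolding sets_lborel borel_eq_box by simp
  then have "(\<integral>x. indicator A x * g x \<partial>lborel) = 0"
  proof (rule sigma_sets_induct_disjoint[rotated 2])
    show "Int_stable (range (\<lambda>(a, b). box a b :: 'a set))"
      by (auto simp: Int_stable_def box_Int_box)
  next
    fix A :: "'a set" assume "A \<in> range (\<lambda>(a, b). box a b)"
    with box show "(\<integral>x. indicator A x * g x \<partial>lborel) = 0" by auto
  next
    \<comment> \<open>For complements the integral over the whole space must vanish as well; it is
      the limit of the integrals over growing boxes.\<close>
    have "(\<lambda>n. \<integral>x. indicator (box (- real n *\<^sub>R One) (real n *\<^sub>R One)) x * g x \<partial>lborel)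
        \<longlonglongrightarrow> (\<integral>x. g x \<partial>lborel)"
    proof (rule integral_dominated_convergence[where w="\<lambda>x. norm (g x)"])
      show "AE x in lborel. (\<lambda>n. indicator (box (- real n *\<^sub>R One) (real n *\<^sub>R One)) x * g x) \<longlonglongrightarrow> g x"
      proof (rule AE_I2)
        fix x :: 'a
        obtain N where N: "x \<in> box (- real N *\<^sub>R One) (real N *\<^sub>R One)"
          using UN_box_eq_UNIV[where 'a='a] by auto
        have "x \<in> box (- real n *\<^sub>R One) (real n *\<^sub>R One)" if "n \<ge> N" for n
          unfolding mem_box
        proof
          fix i :: 'a assume i: "i \<in> Basis"
          with N have "- real N < x \<bullet> i" "x \<bullet> i < real N" by (auto simp: mem_box)
          with that i show "(- real n *\<^sub>R One) \<bullet> i < x \<bullet> i \<and> x \<bullet> i < (real n *\<^sub>R One) \<bullet> i"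
            by simp
        qed
        then have "eventually (\<lambda>n. g x = indicator (box (- real n *\<^sub>R One) (real n *\<^sub>R One)) x * g x) sequentially"
          unfolding eventually_sequentially by (auto intro!: exI[of _ N])
        then show "(\<lambda>n. indicator (box (- real n *\<^sub>R One) (real n *\<^sub>R One)) x * g x) \<longlonglongrightarrow> g x"
          by (rule Lim_transform_eventually[OF tendsto_const])
      qed
    qed (use g in \<open>auto split: split_indicator\<close>)
    then have UNIV: "(\<integral>x. g x \<partial>lborel) = 0"
      unfolding box LIMSEQ_const_iff by simp
    fix A :: "'a set" assume A: "A \<in> sigma_sets UNIV (range (\<lambda>(a, b). box a b))"
      and eq: "(\<integral>x. indicator A x * g x \<partial>lborel) = 0"
    have [measurable]: "A \<in> sets borel"
      using A unfolding borel_eq_box by simp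
    have "(\<integral>x. indicator (UNIV - A) x * g x \<partial>lborel) = (\<integral>x. g x - indicator A x * g x \<partial>lborel)"
      by (intro Bochner_Integration.integral_cong) (auto simp: indicator_def)
    then show "(\<integral>x. indicator (UNIV - A) x * g x \<partial>lborel) = 0"
      using g int[of A] UNIV eq by simp
  next
    fix A :: "nat \<Rightarrow> 'a set"
    assume disj: "disjoint_family A" and A: "range A \<subseteq> sigma_sets UNIV (range (\<lambda>(a, b). box a b))"
      and eq: "\<And>i. (\<integral>x. indicator (A i) x * g x \<partial>lborel) = 0"
    have [measurable]: "A i \<in> sets borel" for i
      using A unfolding borel_eq_box by auto
    have "set_lebesgue_integral lborel (\<Union>i. A i) g = (\<Sum>i. set_lebesgue_integral lborel (A i) g)"
      by (rule lebesgue_integral_countable_add)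
         (use disj int in \<open>auto simp: disjoint_family_on_def set_integrable_def\<close>)
    then show "(\<integral>x. indicator (\<Union>i. A i) x * g x \<partial>lborel) = 0"
      by (simp add: set_lebesgue_integral_def eq)
  qed auto
  then show "set_lebesgue_integral lborel A g = set_lebesgue_integral lborel A (\<lambda>_. 0)"
    by (simp add: set_lebesgue_integral_def)
qed

section \<open>Test functions\<close>

lemma L2_measurable: "f \<in> L2 M \<Longrightarrow> f \<in> borel_measurable M"
  by (simp add: L2_def)

lemma L2_integrable_power2: "f \<in> L2 M \<Longrightarrow> integrable M (\<lambda>x. (f x)\<^sup>2)"
  by (simp add: L2_def)

lemma L2_integrable_mult:
  assumes "f \<in> L2 M" "g \<in> L2 M"
  shows "integrable M (\<lambda>x. f x * g x)"
proof (rule Bochner_Integration.integrable_bound)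
  show "integrable M (\<lambda>x. (f x)\<^sup>2 + (g x)\<^sup>2)"
    using assms by (auto simp: L2_def)
  show "(\<lambda>x. f x * g x) \<in> borel_measurable M"
    using assms by (auto simp: L2_def)
  have "\<bar>a * b\<bar> \<le> a\<^sup>2 + b\<^sup>2" for a b :: real
  proof -
    have "2 * \<bar>a * b\<bar> \<le> a\<^sup>2 + b\<^sup>2"
      using sum_squares_bound[of "\<bar>a\<bar>" "\<bar>b\<bar>"] by (simp add: abs_mult)
    then show ?thesis using abs_ge_zero[of "a * b"] by linarith
  qed
  then show "AE x in M. norm (f x * g x) \<le> norm ((f x)\<^sup>2 + (g x)\<^sup>2)"
    by simp
qed

lemma L2_cmult: "f \<in> L2 M \<Longrightarrow> (\<lambda>x. c * f x) \<in> L2 M"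
  by (auto simp: L2_def power_mult_distrib)

lemma L2_add:
  assumes "f \<in> L2 M" "g \<in> L2 M"
  shows "(\<lambda>x. f x + g x) \<in> L2 M"
  using assms L2_integrable_mult[OF assms] by (auto simp: L2_def power2_sum mult.assoc)

lemma L2_diff:
  assumes "f \<in> L2 M" "g \<in> L2 M"
  shows "(\<lambda>x. f x - g x) \<in> L2 M"
  using L2_add[OF assms(1) L2_cmult[OF assms(2), of "-1"]] by simp

lemma L2norm_power2: "(L2norm M f)\<^sup>2 = (\<integral>x. (f x)\<^sup>2 \<partial>M)"
  by (simp add: L2norm_def)

lemma L2norm_nonneg: "0 \<le> L2norm M f"
  by (simp add: L2norm_def)

lemma L2norm_cong_AE:
  assumes "f \<in> borel_measurable M" "g \<in> borel_measurable M" "AE x in M. f x = g x"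
  shows "L2norm M f = L2norm M g"
  unfolding L2norm_def using assms by (intro arg_cong[where f=sqrt] integral_cong_AE) auto

text \<open>The integrated form of \<open>(a - b)\<^sup>2 + (a + b)\<^sup>2 = 2 * a\<^sup>2 + 2 *
  b\<^sup>2\<close>. It takes the place of the triangle inequality, so that all later estimates can
  be made with squared norms.\<close>

lemma L2norm_power2_diff_le:
  assumes "f \<in> L2 M" "g \<in> L2 M"
  shows "(L2norm M (\<lambda>x. f x - g x))\<^sup>2 \<le> 2 * (L2norm M f)\<^sup>2 + 2 * (L2norm M g)\<^sup>2"
proof -
  have "(\<integral>x. (f x - g x)\<^sup>2 \<partial>M) \<le> (\<integral>x. 2 * (f x)\<^sup>2 + 2 * (g x)\<^sup>2 \<partial>M)"
  proof (rule integral_mono)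
    show "(f x - g x)\<^sup>2 \<le> 2 * (f x)\<^sup>2 + 2 * (g x)\<^sup>2" for x
      using zero_le_power2[of "f x + g x"] by (simp add: power2_sum power2_diff)
  qed (use assms L2_diff[OF assms] in \<open>auto simp: L2_def\<close>)
  then show ?thesis
    using assms by (simp add: L2norm_power2 L2_def)
qed

section \<open>Closure properties and integrals of test functions\<close>

lemma test_functions_smooth: "\<phi> \<in> test_functions \<Omega> \<Longrightarrow> smooth \<phi>"
  by (simp add: test_functions_def)

lemma test_functions_support:
  assumes "\<phi> \<in> test_functions \<Omega>"
  obtains K where "compact K" "K \<subseteq> \<Omega>" "\<And>x. x \<notin> K \<Longrightarrow> \<phi> x = 0"
  using assms by (auto simp: test_functions_def)

lemma test_functions_outside: "\<phi> \<in> test_functions \<Omega> \<Longrightarrow> x \<notin> \<Omega> \<Longrightarrow> \<phi> x = 0"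
  by (auto simp: test_functions_def)

lemma test_functions_measurable: "\<phi> \<in> test_functions \<Omega> \<Longrightarrow> \<phi> \<in> borel_measurable borel"
  by (intro borel_measurable_continuous_onI smooth_continuous test_functions_smooth)

lemma test_functions_mult_smooth:
  "\<phi> \<in> test_functions \<Omega> \<Longrightarrow> smooth g \<Longrightarrow> (\<lambda>x. g x * \<phi> x) \<in> test_functions \<Omega>"
  unfolding test_functions_def by (auto intro: smooth_mult)

lemma test_functions_diff:
  assumes "\<phi> \<in> test_functions \<Omega>" "\<psi> \<in> test_functions \<Omega>"
  shows "(\<lambda>x. \<phi> x - \<psi> x) \<in> test_functions \<Omega>"
proof -
  obtain K where K: "compact K" "K \<subseteq> \<Omega>" "\<And>x. x \<notin> K \<Longrightarrow> \<phi> x = 0"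
    using assms(1) by (rule test_functions_support) blast
  obtain L where L: "compact L" "L \<subseteq> \<Omega>" "\<And>x. x \<notin> L \<Longrightarrow> \<psi> x = 0"
    using assms(2) by (rule test_functions_support) blast
  have "smooth (\<lambda>x. \<phi> x + (- 1) * \<psi> x)"
    using assms by (intro smooth_add smooth_mult smooth_const test_functions_smooth)
  moreover have "\<phi> x - \<psi> x = 0" if "x \<notin> K \<union> L" for x
    using K(3)[of x] L(3)[of x] that by auto
  ultimately show ?thesis
    unfolding test_functions_def using K(1,2) L(1,2) by (auto intro!: exI[of _ "K \<union> L"] compact_Un)
qed

lemma test_functions_pd:
  assumes "\<phi> \<in> test_functions \<Omega>"
  shows "pd i \<phi> \<in> test_functions \<Omega>"
proof -
  obtain K where K: "compact K" "K \<subseteq> \<Omega>" "\<And>x. x \<notin> K \<Longrightarrow> \<phi> x = 0"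
    using assms by (rule test_functions_support) blast
  have "pd i \<phi> x = 0" if "x \<notin> K" for x
  proof -
    have "(\<phi> has_derivative (\<lambda>_. 0)) (at x)"
      by (rule has_derivative_transform_within_open[OF has_derivative_const[of 0], of "- K"])
         (use K that in \<open>auto simp: open_Compl compact_imp_closed\<close>)
    from pd_eqI[OF this] show ?thesis .
  qed
  with K assms smooth_pd show ?thesis
    unfolding test_functions_def by blast
qed

lemma test_functions_mpd:
  assumes "\<phi> \<in> test_functions \<Omega>"
  shows "mpd \<alpha> \<phi> \<in> test_functions \<Omega>"
proof -
  have "(pd i ^^ n) \<phi> \<in> test_functions \<Omega>" if "\<phi> \<in> test_functions \<Omega>" for i n and \<phi>
    using that by (induction n) (auto intro: test_functions_pd)
  with assms show ?thesis by (simp add: mpd_def)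
qed

lemma test_functions_bounded:
  assumes "\<phi> \<in> test_functions \<Omega>"
  obtains B where "B \<ge> 0" "\<And>x. \<bar>\<phi> x\<bar> \<le> B"
proof -
  obtain K where K: "compact K" "\<And>x. x \<notin> K \<Longrightarrow> \<phi> x = 0"
    using assms by (rule test_functions_support) blast
  have "compact (\<phi> ` K)"
    by (intro compact_continuous_image K smooth_continuous test_functions_smooth[OF assms])
  then obtain B where "\<And>x. x \<in> K \<Longrightarrow> norm (\<phi> x) \<le> B"
    using compact_imp_bounded bounded_iff by (metis imageI)
  then have "\<bar>\<phi> x\<bar> \<le> max B 0" for x
    using K(2)[of x] by (cases "x \<in> K") (auto simp: le_max_iff_disj)
  then show ?thesis by (intro that[of "max B 0"]) auto
qed

lemma test_functions_integrable:
  assumes "\<phi> \<in> test_functions \<Omega>"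
  shows "integrable lborel \<phi>"
proof -
  obtain K where K: "compact K" "\<And>x. x \<notin> K \<Longrightarrow> \<phi> x = 0"
    using assms by (rule test_functions_support) blast
  have "integrable lborel (\<lambda>x. indicator K x *\<^sub>R \<phi> x)"
    by (intro borel_integrable_compact K smooth_continuous test_functions_smooth[OF assms])
  also have "(\<lambda>x. indicator K x *\<^sub>R \<phi> x) = \<phi>"
    using K by (auto simp: indicator_def fun_eq_iff)
  finally show ?thesis .
qed

text \<open>The integral of a difference quotient vanishes by translation invariance.\<close>

lemma integral_pd_test_function:
  assumes \<phi>: "\<phi> \<in> test_functions \<Omega>"
  shows "(\<integral>x. pd i \<phi> x \<partial>lborel) = 0"
proof -
  let ?e = "axis i 1 :: real^2"
  let ?D = "\<lambda>n x. (\<phi> (x + inverse (real (Suc n)) *\<^sub>R ?e) - \<phi> x) / inverse (real (Suc n))"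
  obtain B where B: "B \<ge> 0" "\<And>x. \<bar>pd i \<phi> x\<bar> \<le> B"
    using test_functions_bounded[OF test_functions_pd[OF \<phi>]] by blast
  obtain K where K: "compact K" "\<And>x. x \<notin> K \<Longrightarrow> \<phi> x = 0"
    using \<phi> by (rule test_functions_support) blast
  obtain R where R: "\<And>x. x \<in> K \<Longrightarrow> norm x \<le> R"
    using compact_imp_bounded[OF K(1)] bounded_iff by metis
  have der: "((\<lambda>t. \<phi> (x + t *\<^sub>R ?e)) has_field_derivative pd i \<phi> (x + t *\<^sub>R ?e)) (at t)" for x t
    using pd_has_field_derivative_line smooth_differentiable test_functions_smooth[OF \<phi>] by blast
  have m[measurable]: "\<phi> \<in> borel_measurable borel" "pd i \<phi> \<in> borel_measurable borel"
    using \<phi> by (auto intro: test_functions_measurable test_functions_pd)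
  \<comment> \<open>The dominating function: \<open>B\<close> bounds the quotient by the mean value
    theorem, and as the step is at most 1, the quotient vanishes off the ball of radius
    \<open>R + 1\<close>.\<close>
  have bound: "norm (?D n x) \<le> B * indicator (cball 0 (R + 1)) x" for n x
  proof (cases "x \<in> cball 0 (R + 1)")
    case True
    obtain z where "\<phi> (x + inverse (real (Suc n)) *\<^sub>R ?e) - \<phi> (x + 0 *\<^sub>R ?e) =
        (inverse (real (Suc n)) - 0) * pd i \<phi> (x + z *\<^sub>R ?e)"
      using MVT2[of 0 "inverse (real (Suc n))" "\<lambda>t. \<phi> (x + t *\<^sub>R ?e)" "\<lambda>t. pd i \<phi> (x + t *\<^sub>R ?e)"] der
      by (auto simp del: of_nat_Suc)
    then have "?D n x = pd i \<phi> (x + z *\<^sub>R ?e)"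
      by (simp del: of_nat_Suc)
    with B True show ?thesis by (simp del: of_nat_Suc)
  next
    case False
    have "norm (inverse (real (Suc n)) *\<^sub>R ?e) \<le> 1"
      by (simp add: field_simps)
    with False norm_triangle_ineq4[of "x + inverse (real (Suc n)) *\<^sub>R ?e" "inverse (real (Suc n)) *\<^sub>R ?e"]
    have "\<not> norm x \<le> R" "\<not> norm (x + inverse (real (Suc n)) *\<^sub>R ?e) \<le> R"
      by (auto simp del: of_nat_Suc)
    then have "\<phi> x = 0" "\<phi> (x + inverse (real (Suc n)) *\<^sub>R ?e) = 0"
      using R K by blast+
    with B show ?thesis by simp
  qed
  have "(\<integral>x. \<phi> (x + c) \<partial>lborel) = (\<integral>x. \<phi> x \<partial>lborel)" for c
    using integral_distr[of "(+) c" lborel borel \<phi>] lborel_distr_plus[of c] by (simp add: add.commute)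
  moreover have "integrable lborel (\<lambda>x. \<phi> (x + c))" for c
    using integrable_distr_eq[of "(+) c" lborel borel \<phi>] lborel_distr_plus[of c]
      test_functions_integrable[OF \<phi>] by (simp add: add.commute)
  ultimately have "(\<integral>x. ?D n x \<partial>lborel) = 0" for n
    using test_functions_integrable[OF \<phi>] by (simp del: of_nat_Suc)
  moreover have "(\<lambda>n. \<integral>x. ?D n x \<partial>lborel) \<longlonglongrightarrow> (\<integral>x. pd i \<phi> x \<partial>lborel)"
  proof (rule integral_dominated_convergence[where w="\<lambda>x. B * indicator (cball 0 (R + 1)) x"])
    show "integrable lborel (\<lambda>x. B * indicator (cball 0 (R + 1)) x :: real)"
      using emeasure_bounded_finite[OF bounded_cball, of 0 "R + 1"] by (auto intro!: integrable_real_indicator)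
    show "AE x in lborel. (\<lambda>n. ?D n x) \<longlonglongrightarrow> pd i \<phi> x"
    proof (rule AE_I2)
      fix x
      have "((\<lambda>h. (\<phi> (x + h *\<^sub>R ?e) - \<phi> x) / h) \<longlongrightarrow> pd i \<phi> x) (at 0)"
        using der[of x 0] by (simp add: DERIV_def)
      moreover have "filterlim (\<lambda>n. inverse (real (Suc n))) (at 0) sequentially"
        unfolding filterlim_at using LIMSEQ_inverse_real_of_nat by (auto simp del: of_nat_Suc)
      ultimately show "(\<lambda>n. ?D n x) \<longlonglongrightarrow> pd i \<phi> x"
        by (rule filterlim_compose)
    qed
  qed (use bound in auto)
  ultimately show ?thesis
    by (simp add: LIMSEQ_const_iff)
qed

text \<open>Bridge between the restricted Lebesgue measure of the definitions and
  \<open>lborel\<close>, on which translation invariance was used: a function that vanishes off the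
  domain is its own restriction.\<close>

lemma integral_lebesgue_on_eq_lborel:
  assumes "open \<Omega>" "f \<in> borel_measurable borel" "\<And>x. x \<notin> \<Omega> \<Longrightarrow> f x = (0::real)"
  shows "(\<integral>x. f x \<partial>lebesgue_on \<Omega>) = (\<integral>x. f x \<partial>lborel)"
proof -
  have "(\<integral>x. f x \<partial>lebesgue_on \<Omega>) = (\<integral>x. indicator \<Omega> x *\<^sub>R f x \<partial>lebesgue)"
    using assms by (intro integral_restrict_space) auto
  also have "(\<lambda>x. indicator \<Omega> x *\<^sub>R f x) = f"
    using assms by (auto simp: indicator_def fun_eq_iff)
  finally show ?thesis using assms by (simp add: integral_completion)
qed

lemma integrable_lebesgue_on_if_lborel:
  assumes "open \<Omega>" "integrable lborel f" "\<And>x. x \<notin> \<Omega> \<Longrightarrow> f x = (0::real)"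
  shows "integrable (lebesgue_on \<Omega>) f"
proof -
  have "(\<lambda>x. indicator \<Omega> x *\<^sub>R f x) = f"
    using assms by (auto simp: indicator_def fun_eq_iff)
  then show ?thesis
    using assms by (subst integrable_restrict_space) (auto simp: integrable_completion)
qed

lemma test_functions_L2:
  assumes "open \<Omega>" "\<phi> \<in> test_functions \<Omega>"
  shows "\<phi> \<in> L2 (lebesgue_on \<Omega>)"
proof -
  have "(\<lambda>x. \<phi> x * \<phi> x) \<in> test_functions \<Omega>"
    using assms by (intro test_functions_mult_smooth test_functions_smooth)
  then have "integrable (lebesgue_on \<Omega>) (\<lambda>x. \<phi> x * \<phi> x)"
    by (intro integrable_lebesgue_on_if_lborel test_functions_integrable)
       (use assms test_functions_outside in auto)
  moreover have "\<phi> \<in> borel_measurable (lebesgue_on \<Omega>)"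
    using test_functions_measurable[OF assms(2)]
    by (intro measurable_restrict_space1 measurable_completion) simp
  ultimately show ?thesis by (simp add: L2_def power2_eq_square)
qed

text \<open>The product of two test functions is a test function, so its derivative integrates to
  0.\<close>

lemma integral_by_parts_test_functions:
  assumes "open \<Omega>" "\<phi> \<in> test_functions \<Omega>" "\<psi> \<in> test_functions \<Omega>"
  shows "(\<integral>x. \<phi> x * pd i \<psi> x \<partial>lebesgue_on \<Omega>) = - (\<integral>x. pd i \<phi> x * \<psi> x \<partial>lebesgue_on \<Omega>)"
proof -
  note sm = assms(2,3)[THEN test_functions_smooth]
  have T: "(\<lambda>x. \<phi> x * \<psi> x) \<in> test_functions \<Omega>"
    using assms sm by (intro test_functions_mult_smooth)
  have "(\<integral>x. pd i \<phi> x * \<psi> x + \<phi> x * pd i \<psi> x \<partial>lebesgue_on \<Omega>) =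
      (\<integral>x. pd i (\<lambda>x. \<phi> x * \<psi> x) x \<partial>lebesgue_on \<Omega>)"
    using sm by (simp add: pd_mult smooth_differentiable)
  also have "\<dots> = 0"
    using integral_lebesgue_on_eq_lborel[OF assms(1) test_functions_measurable[OF test_functions_pd[OF T, of i]]
        test_functions_outside[OF test_functions_pd[OF T, of i]]] integral_pd_test_function[OF T, of i]
    by simp
  also have "(\<integral>x. pd i \<phi> x * \<psi> x + \<phi> x * pd i \<psi> x \<partial>lebesgue_on \<Omega>) =
      (\<integral>x. pd i \<phi> x * \<psi> x \<partial>lebesgue_on \<Omega>) + (\<integral>x. \<phi> x * pd i \<psi> x \<partial>lebesgue_on \<Omega>)"
    using assms by (intro Bochner_Integration.integral_add L2_integrable_mult test_functions_L2 test_functions_pd)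
  finally show ?thesis by simp
qed

text \<open>The fundamental lemma of the calculus of variations. Inside a closed box contained in
  the domain, bump functions converge to indicators of smaller boxes under a common integrable
  bound, which reduces the claim to integrals over boxes.\<close>

lemma AE_eq_0_if_integrals_test_functions_0:
  assumes op: "open \<Omega>" and f: "f \<in> L2 (lebesgue_on \<Omega>)"
    and 0: "\<And>\<phi>. \<phi> \<in> test_functions \<Omega> \<Longrightarrow> (\<integral>x. f x * \<phi> x \<partial>lebesgue_on \<Omega>) = 0"
  shows "AE x in lebesgue_on \<Omega>. f x = 0"
proof -
  have \<Omega>: "\<Omega> \<in> sets lebesgue" "\<Omega> \<inter> space lebesgue \<in> sets lebesgue"
    using op by auto
  define F where "F = (\<lambda>x. indicator \<Omega> x * f x)"
  have F: "F \<in> borel_measurable lebesgue"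
    using L2_measurable[OF f] borel_measurable_restrict_space_iff[OF \<Omega>(2), of f]
    by (simp add: F_def mult.commute)
  \<comment> \<open>The criterion on boxes concerns \<open>lborel\<close>, so the Lebesgue
    measurable \<open>F\<close> is replaced by a Borel function that equals it almost
    everywhere.\<close>
  obtain g where g[measurable]: "g \<in> borel_measurable borel" and "AE x in lborel. F x = g x"
    using completion_ex_borel_measurable_real[OF F] by auto
  then have Fg: "AE x in lebesgue. F x = g x"
    using AE_completion by blast
  have box: "AE x in lebesgue. x \<in> cbox a b \<longrightarrow> F x = 0" if ab: "cbox a b \<subseteq> \<Omega>" for a b
  proof -
    have "(\<lambda>x. indicator (box a b) x :: real) \<in> L2 (lebesgue_on \<Omega>)"
    proof -
      have "box a b \<subseteq> \<Omega>" using ab box_subset_cbox by blast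
      have "(indicator (box a b) x)\<^sup>2 = (indicator (box a b) x :: real)" for x
        by (simp add: indicator_def)
      moreover have "integrable (lebesgue_on \<Omega>) (indicator (box a b) :: _ \<Rightarrow> real)"
      proof (intro integrable_lebesgue_on_if_lborel integrable_real_indicator op)
        show "emeasure lborel (box a b) < \<infinity>"
          by (rule emeasure_bounded_finite[OF bounded_box])
      qed (use \<open>box a b \<subseteq> \<Omega>\<close> in \<open>auto simp: indicator_def\<close>)
      ultimately show ?thesis
        by (simp add: L2_def borel_measurable_integrable)
    qed
    from L2_integrable_mult[OF this f] have "integrable lebesgue (\<lambda>x. indicator \<Omega> x *\<^sub>R (indicator (box a b) x * f x))"
      by (subst (asm) integrable_restrict_space[OF \<Omega>(2)])
    also have "(\<lambda>x. indicator \<Omega> x *\<^sub>R (indicator (box a b) x * f x)) = (\<lambda>x. indicator (box a b) x * F x)"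
      by (auto simp: F_def fun_eq_iff)
    finally have intF: "integrable lebesgue (\<lambda>x. indicator (box a b) x * F x)" .
    then have "integrable lebesgue (\<lambda>x. indicator (box a b) x * g x)"
    proof (subst integrable_cong_AE)
      show "(\<lambda>x. indicator (box a b) x * g x) \<in> borel_measurable lebesgue"
        by (rule measurable_completion) simp
      show "AE x in lebesgue. indicator (box a b) x * g x = indicator (box a b) x * F x"
        using Fg by eventually_elim simp
    qed (auto intro: borel_measurable_integrable)
    then have intg: "integrable lborel (\<lambda>x. indicator (box a b) x * g x)"
      by (rule integrable_completion[THEN iffD1, rotated]) simp
    \<comment> \<open>Two boxes intersect in a box, to which the bump approximation applies. Its
      members vanish off \<open>cbox a b\<close>, which lies in the domain, and are thus admissible
      test functions.\<close>
    have "(\<integral>x. indicator (box c d) x * (indicator (box a b) x * g x) \<partial>lborel) = 0" for c d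
    proof -
      obtain a' b' where I: "box a' b' = box c d \<inter> box a b"
        unfolding box_Int_box by blast
      obtain \<psi> where \<psi>: "\<And>k. smooth (\<psi> k)" "\<And>k x. 0 \<le> \<psi> k x \<and> \<psi> k x \<le> indicator (box a' b') x"
        "\<And>x. (\<lambda>k. \<psi> k x) \<longlonglongrightarrow> indicator (box a' b') x"
        using box_bump_approximation[of a' b'] by blast
      have "indicator (box a' b') x \<le> (indicator (box a b) x :: real)" for x
        unfolding I by (simp add: indicator_def)
      then have le: "\<psi> k x \<le> indicator (box a b) x" for k x
        using \<psi>(2) order_trans by blast
      have T: "\<psi> k \<in> test_functions \<Omega>" for k
        unfolding test_functions_def
      proof (intro CollectI conjI exI[of _ "cbox a b"] allI impI)
        show "\<psi> k x = 0" if "x \<notin> cbox a b" for x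
        proof -
          have "x \<notin> box a b" using that box_subset_cbox by blast
          with le[of k x] \<psi>(2)[of k x] show ?thesis by simp
        qed
      qed (simp_all add: \<psi>(1) ab)
      have "(\<integral>x. \<psi> k x * F x \<partial>lebesgue) = 0" for k
        using 0[OF T[of k]] \<Omega> by (simp add: integral_restrict_space F_def mult_ac)
      moreover have "(\<lambda>k. \<integral>x. \<psi> k x * F x \<partial>lebesgue) \<longlonglongrightarrow> (\<integral>x. indicator (box a' b') x * F x \<partial>lebesgue)"
      proof (rule integral_dominated_convergence[where w="\<lambda>x. norm (indicator (box a b) x * F x)"])
        show "AE x in lebesgue. (\<lambda>k. \<psi> k x * F x) \<longlonglongrightarrow> indicator (box a' b') x * F x"
          by (intro AE_I2 tendsto_mult \<psi>(3) tendsto_const)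
        show "AE x in lebesgue. norm (\<psi> k x * F x) \<le> norm (indicator (box a b) x * F x)" for k
        proof (intro AE_I2)
          fix x show "norm (\<psi> k x * F x) \<le> norm (indicator (box a b) x * F x)"
            using le[of k x] \<psi>(2)[of k x] by (simp add: abs_mult mult_right_mono)
        qed
        show "(\<lambda>x. \<psi> k x * F x) \<in> borel_measurable lebesgue" for k
          by (intro borel_measurable_times F measurable_completion)
             (simp add: test_functions_measurable[OF T])
        show "(\<lambda>x. indicator (box a' b') x * F x) \<in> borel_measurable lebesgue"
          by (rule borel_measurable_times[OF measurable_completion F]) simp
      qed (rule integrable_norm[OF intF])
      ultimately have "(\<integral>x. indicator (box a' b') x * F x \<partial>lebesgue) = 0"
        by (simp add: LIMSEQ_const_iff)
      also have "(\<integral>x. indicator (box a' b') x * F x \<partial>lebesgue) =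
          (\<integral>x. indicator (box a' b') x * g x \<partial>lebesgue)"
      proof (rule integral_cong_AE)
        show "AE x in lebesgue. indicator (box a' b') x * F x = indicator (box a' b') x * g x"
          using Fg by eventually_elim simp
        show "(\<lambda>x. indicator (box a' b') x * F x) \<in> borel_measurable lebesgue"
          by (rule borel_measurable_times[OF measurable_completion F]) simp
        show "(\<lambda>x. indicator (box a' b') x * g x) \<in> borel_measurable lebesgue"
          by (rule measurable_completion) simp
      qed
      also have "\<dots> = (\<integral>x. indicator (box a' b') x * g x \<partial>lborel)"
        by (rule integral_completion) simp
      also have "(\<lambda>x. indicator (box a' b') x * g x) = (\<lambda>x. indicator (box c d) x * (indicator (box a b) x * g x))"
        unfolding I by (simp add: indicator_inter_arith mult.assoc)
      finally show ?thesis .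
    qed
    from AE_eq_0_if_box_integrals_0[OF intg this]
    have "AE x in lebesgue. indicator (box a b) x * g x = 0"
      using AE_completion by blast
    moreover have "AE x in lebesgue. x \<notin> cbox a b - box a b"
      by (intro AE_not_in) (simp add: negligible_frontier_interval flip: negligible_iff_null_sets)
    ultimately show ?thesis
      using Fg by eventually_elim (auto simp: indicator_def)
  qed
  \<comment> \<open>Countably many closed boxes cover the open domain, so the exceptional null sets
    can be united.\<close>
  obtain \<D> where \<D>: "countable \<D>" "\<D> \<subseteq> Pow \<Omega>" "\<And>X. X \<in> \<D> \<Longrightarrow> \<exists>a b. X = cbox a b" "\<Union>\<D> = \<Omega>"
    by (rule open_countable_Union_open_cbox[OF op]) (rule that)
  have "AE x in lebesgue. x \<in> X \<longrightarrow> F x = 0" if "X \<in> \<D>" for X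
    using \<D>(2) \<D>(3)[OF that] that box by blast
  then have "AE x in lebesgue. \<forall>X\<in>\<D>. x \<in> X \<longrightarrow> F x = 0"
    by (subst AE_ball_countable[OF \<D>(1)]) blast
  then have "AE x in lebesgue. x \<in> \<Omega> \<longrightarrow> f x = 0"
    unfolding F_def by eventually_elim (use \<D>(4) in \<open>auto simp: indicator_def\<close>)
  then show ?thesis
    by (subst AE_restrict_space_iff[OF \<Omega>(2)])
qed

section \<open>The space \<open>H\<^sup>1\<^sub>0\<close>\<close>

lemma has_weak_deriv_wderiv: "has_weak_deriv \<Omega> \<alpha> f g \<Longrightarrow> has_weak_deriv \<Omega> \<alpha> f (wderiv \<Omega> \<alpha> f)"
  unfolding wderiv_def by (rule someI[of "has_weak_deriv \<Omega> \<alpha> f"])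

lemma has_weak_deriv_L2: "has_weak_deriv \<Omega> \<alpha> f g \<Longrightarrow> g \<in> L2 (lebesgue_on \<Omega>)"
  by (simp add: has_weak_deriv_def)

text \<open>Since \<open>wderiv\<close> is an arbitrary choice, each rule for \<open>wpd\<close> is
  obtained by comparing the chosen representative with an explicit weak derivative, and hence holds
  almost everywhere.\<close>

lemma has_weak_deriv_unique:
  assumes op: "open \<Omega>" and g: "has_weak_deriv \<Omega> \<alpha> f g" and g': "has_weak_deriv \<Omega> \<alpha> f g'"
  shows "AE x in lebesgue_on \<Omega>. g x = g' x"
proof -
  note L = has_weak_deriv_L2[OF g] has_weak_deriv_L2[OF g']
  have "AE x in lebesgue_on \<Omega>. g x - g' x = 0"
  proof (rule AE_eq_0_if_integrals_test_functions_0[OF op L2_diff[OF L]])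
    fix \<phi> assume \<phi>: "\<phi> \<in> test_functions \<Omega>"
    have "(\<integral>x. f x * mpd \<alpha> \<phi> x \<partial>lebesgue_on \<Omega>) = (-1) ^ order_of \<alpha> * (\<integral>x. g x * \<phi> x \<partial>lebesgue_on \<Omega>)"
      using g \<phi> by (simp add: has_weak_deriv_def)
    moreover have "(\<integral>x. f x * mpd \<alpha> \<phi> x \<partial>lebesgue_on \<Omega>) = (-1) ^ order_of \<alpha> * (\<integral>x. g' x * \<phi> x \<partial>lebesgue_on \<Omega>)"
      using g' \<phi> by (simp add: has_weak_deriv_def)
    ultimately have "(\<integral>x. g x * \<phi> x \<partial>lebesgue_on \<Omega>) = (\<integral>x. g' x * \<phi> x \<partial>lebesgue_on \<Omega>)"
      by simp
    then show "(\<integral>x. (g x - g' x) * \<phi> x \<partial>lebesgue_on \<Omega>) = 0"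
      using L[THEN L2_integrable_mult[OF _ test_functions_L2[OF op \<phi>]]]
      by (simp add: left_diff_distrib)
  qed
  then show ?thesis by simp
qed

lemma has_weak_deriv_diff:
  assumes op: "open \<Omega>" and "f \<in> L2 (lebesgue_on \<Omega>)" "f' \<in> L2 (lebesgue_on \<Omega>)"
    and g: "has_weak_deriv \<Omega> \<alpha> f g" and g': "has_weak_deriv \<Omega> \<alpha> f' g'"
  shows "has_weak_deriv \<Omega> \<alpha> (\<lambda>x. f x - f' x) (\<lambda>x. g x - g' x)"
  unfolding has_weak_deriv_def
proof (intro conjI ballI)
  show "(\<lambda>x. g x - g' x) \<in> L2 (lebesgue_on \<Omega>)"
    using g g' by (intro L2_diff has_weak_deriv_L2)
  fix \<phi> assume \<phi>: "\<phi> \<in> test_functions \<Omega>"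
  note int = L2_integrable_mult[OF _ test_functions_L2[OF op]]
  show "(\<integral>x. (f x - f' x) * mpd \<alpha> \<phi> x \<partial>lebesgue_on \<Omega>) =
      (-1) ^ order_of \<alpha> * (\<integral>x. (g x - g' x) * \<phi> x \<partial>lebesgue_on \<Omega>)"
    using int[OF assms(2) test_functions_mpd[OF \<phi>]] int[OF assms(3) test_functions_mpd[OF \<phi>]]
      int[OF has_weak_deriv_L2[OF g] \<phi>] int[OF has_weak_deriv_L2[OF g'] \<phi>] g g' \<phi>
    by (simp add: left_diff_distrib right_diff_distrib has_weak_deriv_def)
qed

text \<open>An abbreviation, so that it is syntactically the multi-index in
  \<open>wpd_def\<close>.\<close>

abbreviation unit_index :: "2 \<Rightarrow> mindex" where
  "unit_index i \<equiv> \<lambda>j. if j = i then 1 else 0"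

lemma order_of_unit_index: "order_of (unit_index i) = 1"
  by (simp add: order_of_def)

lemma mpd_unit_index: "mpd (unit_index i) f = pd i f"
  using exhaust_2[of i] by (auto simp: mpd_def)

lemma mpd_zero: "mpd (\<lambda>_. 0) f = f"
  by (simp add: mpd_def)

lemma order_of_le_1: "{\<alpha>. order_of \<alpha> \<le> 1} = {\<lambda>_. 0, unit_index 1, unit_index 2}"
proof -
  have "\<alpha> \<in> {\<lambda>_. 0, unit_index 1, unit_index 2}" if "order_of \<alpha> \<le> 1" for \<alpha>
  proof -
    have "\<alpha> 1 + \<alpha> 2 \<le> 1" using that by (simp add: order_of_def sum_2)
    then consider "\<alpha> 1 = 0" "\<alpha> 2 = 0" | "\<alpha> 1 = 1" "\<alpha> 2 = 0" | "\<alpha> 1 = 0" "\<alpha> 2 = 1"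
      by linarith
    then show ?thesis by cases (simp_all add: fun_eq_iff forall_2)
  qed
  then show ?thesis
    by (auto simp: order_of_unit_index simp del: One_nat_def) (simp_all add: order_of_def)
qed

lemma has_weak_deriv_zero: "f \<in> L2 (lebesgue_on \<Omega>) \<Longrightarrow> has_weak_deriv \<Omega> (\<lambda>_. 0) f f"
  by (simp add: has_weak_deriv_def mpd_zero order_of_def)

lemma has_weak_deriv_unit_index:
  "has_weak_deriv \<Omega> (unit_index i) f g \<longleftrightarrow> g \<in> L2 (lebesgue_on \<Omega>) \<and>
    (\<forall>\<phi>\<in>test_functions \<Omega>. (\<integral>x. f x * pd i \<phi> x \<partial>(lebesgue_on \<Omega>)) = - (\<integral>x. g x * \<phi> x \<partial>(lebesgue_on \<Omega>)))"
  by (simp add: has_weak_deriv_def mpd_unit_index order_of_unit_index)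

lemma has_weak_deriv_test_function:
  assumes "open \<Omega>" "\<phi> \<in> test_functions \<Omega>"
  shows "has_weak_deriv \<Omega> (unit_index i) \<phi> (pd i \<phi>)"
  unfolding has_weak_deriv_unit_index
  using assms by (intro conjI ballI test_functions_L2 test_functions_pd integral_by_parts_test_functions)

section \<open>The first-order Sobolev space and its norm\<close>

lemma Hspace_L2: "f \<in> Hspace \<Omega> m \<Longrightarrow> f \<in> L2 (lebesgue_on \<Omega>)"
  by (simp add: Hspace_def)

lemma Hspace_1_has_weak_deriv:
  assumes "f \<in> Hspace \<Omega> 1"
  shows "has_weak_deriv \<Omega> (unit_index i) f (wpd \<Omega> i f)"
proof -
  obtain g where "has_weak_deriv \<Omega> (unit_index i) f g"
    using assms order_of_unit_index[of i] unfolding Hspace_def by fastforce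
  then show ?thesis
    unfolding wpd_def by (rule has_weak_deriv_wderiv)
qed

lemma wpd_L2: "f \<in> Hspace \<Omega> 1 \<Longrightarrow> wpd \<Omega> i f \<in> L2 (lebesgue_on \<Omega>)"
  by (rule has_weak_deriv_L2[OF Hspace_1_has_weak_deriv])

lemma Hspace_1I:
  assumes "f \<in> L2 (lebesgue_on \<Omega>)" "\<And>i. has_weak_deriv \<Omega> (unit_index i) f (g i)"
  shows "f \<in> Hspace \<Omega> 1"
  unfolding Hspace_def
proof (intro CollectI conjI allI impI assms(1))
  fix \<alpha> assume "order_of \<alpha> \<le> 1"
  then have "\<alpha> \<in> {\<lambda>_. 0, unit_index 1, unit_index 2}"
    using order_of_le_1 by auto
  then show "\<exists>g. has_weak_deriv \<Omega> \<alpha> f g"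
    using has_weak_deriv_zero[OF assms(1)] assms(2) by blast
qed

lemma test_functions_Hspace_1:
  "open \<Omega> \<Longrightarrow> \<phi> \<in> test_functions \<Omega> \<Longrightarrow> \<phi> \<in> Hspace \<Omega> 1"
  by (rule Hspace_1I[OF test_functions_L2 has_weak_deriv_test_function])

lemma Hspace_1_diff:
  assumes "open \<Omega>" "f \<in> Hspace \<Omega> 1" "g \<in> Hspace \<Omega> 1"
  shows "(\<lambda>x. f x - g x) \<in> Hspace \<Omega> 1"
  by (rule Hspace_1I[OF L2_diff[OF assms(2,3)[THEN Hspace_L2]]
      has_weak_deriv_diff[OF assms(1) assms(2,3)[THEN Hspace_L2] assms(2,3)[THEN Hspace_1_has_weak_deriv]]])

lemma wpd_diff:
  assumes "open \<Omega>" "f \<in> Hspace \<Omega> 1" "g \<in> Hspace \<Omega> 1"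
  shows "AE x in lebesgue_on \<Omega>. wpd \<Omega> i (\<lambda>x. f x - g x) x = wpd \<Omega> i f x - wpd \<Omega> i g x"
  using assms
  by (intro has_weak_deriv_unique[OF _ Hspace_1_has_weak_deriv has_weak_deriv_diff]
      Hspace_L2 Hspace_1_has_weak_deriv Hspace_1_diff)

lemma wpd_test_function:
  assumes "open \<Omega>" "\<phi> \<in> test_functions \<Omega>"
  shows "AE x in lebesgue_on \<Omega>. wpd \<Omega> i \<phi> x = pd i \<phi> x"
  using assms
  by (intro has_weak_deriv_unique[OF _ Hspace_1_has_weak_deriv has_weak_deriv_test_function]
      test_functions_Hspace_1)

lemma L2norm_wpd_diff:
  assumes "open \<Omega>" "f \<in> Hspace \<Omega> 1" "g \<in> Hspace \<Omega> 1"
  shows "L2norm (lebesgue_on \<Omega>) (wpd \<Omega> i (\<lambda>x. f x - g x)) =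
    L2norm (lebesgue_on \<Omega>) (\<lambda>x. wpd \<Omega> i f x - wpd \<Omega> i g x)"
  using assms
  by (intro L2norm_cong_AE wpd_diff L2_measurable[OF L2_diff] L2_measurable[OF wpd_L2] wpd_L2 Hspace_1_diff)

lemma Hnorm_nonneg: "0 \<le> Hnorm \<Omega> m f"
  by (simp add: Hnorm_def sum_nonneg)

text \<open>Even the zeroth-order term of \<open>Hnorm\<close> is a chosen representative of a weak
  derivative. Uniqueness identifies it with \<open>f\<close> up to a null set.\<close>

lemma Hnorm_1_power2:
  assumes "open \<Omega>" "f \<in> Hspace \<Omega> 1"
  shows "(Hnorm \<Omega> 1 f)\<^sup>2 = (L2norm (lebesgue_on \<Omega>) f)\<^sup>2 +
    (L2norm (lebesgue_on \<Omega>) (wpd \<Omega> 1 f))\<^sup>2 + (L2norm (lebesgue_on \<Omega>) (wpd \<Omega> 2 f))\<^sup>2"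
proof -
  have L: "f \<in> L2 (lebesgue_on \<Omega>)" using assms Hspace_L2 by blast
  note w = has_weak_deriv_wderiv[OF has_weak_deriv_zero[OF L]]
  have "L2norm (lebesgue_on \<Omega>) (wderiv \<Omega> (\<lambda>_. 0) f) = L2norm (lebesgue_on \<Omega>) f"
    using assms(1) by (intro L2norm_cong_AE L2_measurable has_weak_deriv_L2[OF w] L
        has_weak_deriv_unique[OF _ w has_weak_deriv_zero[OF L]])
  moreover have "unit_index 1 \<noteq> unit_index 2" "(\<lambda>_. 0) \<noteq> unit_index i" for i
    by (auto simp: fun_eq_iff)
  ultimately show ?thesis
    unfolding Hnorm_def order_of_le_1 by (simp add: sum_nonneg wpd_def add.assoc)
qed

lemma Hnorm_1_diff_le:
  assumes "open \<Omega>" "f \<in> Hspace \<Omega> 1" "g \<in> Hspace \<Omega> 1"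
  shows "(Hnorm \<Omega> 1 (\<lambda>x. f x - g x))\<^sup>2 \<le> 2 * (Hnorm \<Omega> 1 f)\<^sup>2 + 2 * (Hnorm \<Omega> 1 g)\<^sup>2"
  using L2norm_power2_diff_le[OF Hspace_L2 Hspace_L2, OF assms(2,3)]
    L2norm_power2_diff_le[OF wpd_L2 wpd_L2, OF assms(2,3), of 1 1]
    L2norm_power2_diff_le[OF wpd_L2 wpd_L2, OF assms(2,3), of 2 2]
  unfolding Hnorm_1_power2[OF assms(1,2)] Hnorm_1_power2[OF assms(1,3)]
    Hnorm_1_power2[OF assms(1) Hspace_1_diff[OF assms]] L2norm_wpd_diff[OF assms]
  by simp

section \<open>Density of test functions, Poincare's inequality and the exchange of
  derivatives\<close>

lemma H10_Hspace: "f \<in> H10 \<Omega> \<Longrightarrow> f \<in> Hspace \<Omega> 1"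
  by (simp add: H10_def)

lemma H10_approx:
  assumes "f \<in> H10 \<Omega>" "\<epsilon> > 0"
  obtains \<phi> where "\<phi> \<in> test_functions \<Omega>" "(Hnorm \<Omega> 1 (\<lambda>x. f x - \<phi> x))\<^sup>2 < \<epsilon>"
proof -
  have "sqrt \<epsilon> > 0" using assms by simp
  with assms(1) obtain \<phi> where \<phi>: "\<phi> \<in> test_functions \<Omega>" "Hnorm \<Omega> 1 (\<lambda>x. f x - \<phi> x) < sqrt \<epsilon>"
    unfolding H10_def by blast
  have "(Hnorm \<Omega> 1 (\<lambda>x. f x - \<phi> x))\<^sup>2 < (sqrt \<epsilon>)\<^sup>2"
    by (rule power_strict_mono[OF \<phi>(2) Hnorm_nonneg]) simp
  with \<phi>(1) assms(2) show ?thesis by (intro that) simp_all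
qed

lemma H10_diff:
  assumes op: "open \<Omega>" and f: "f \<in> H10 \<Omega>" and g: "g \<in> H10 \<Omega>"
  shows "(\<lambda>x. f x - g x) \<in> H10 \<Omega>"
  unfolding H10_def
proof (intro CollectI conjI allI impI)
  show "(\<lambda>x. f x - g x) \<in> Hspace \<Omega> 1"
    using assms by (intro Hspace_1_diff H10_Hspace)
  fix \<epsilon> :: real assume \<epsilon>: "\<epsilon> > 0"
  \<comment> \<open>Each of the two squared errors is doubled by \<open>Hnorm_1_diff_le\<close>; a
    quarter for each makes the sum stay below the square of \<epsilon>.\<close>
  then have pos: "\<epsilon>\<^sup>2 / 4 > 0" by simp
  obtain \<phi> where \<phi>: "\<phi> \<in> test_functions \<Omega>" "(Hnorm \<Omega> 1 (\<lambda>x. f x - \<phi> x))\<^sup>2 < \<epsilon>\<^sup>2 / 4"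
    using H10_approx[OF f pos] .
  obtain \<psi> where \<psi>: "\<psi> \<in> test_functions \<Omega>" "(Hnorm \<Omega> 1 (\<lambda>x. g x - \<psi> x))\<^sup>2 < \<epsilon>\<^sup>2 / 4"
    using H10_approx[OF g pos] .
  have "(\<lambda>x. f x - g x - (\<phi> x - \<psi> x)) = (\<lambda>x. f x - \<phi> x - (g x - \<psi> x))"
    by (simp add: algebra_simps)
  then have "(Hnorm \<Omega> 1 (\<lambda>x. f x - g x - (\<phi> x - \<psi> x)))\<^sup>2 < \<epsilon>\<^sup>2"
    using Hnorm_1_diff_le[OF op Hspace_1_diff Hspace_1_diff, OF op H10_Hspace[OF f]
        test_functions_Hspace_1 op H10_Hspace[OF g] test_functions_Hspace_1, OF op \<phi>(1) op \<psi>(1)] \<phi>(2) \<psi>(2)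
    by simp
  then have "Hnorm \<Omega> 1 (\<lambda>x. f x - g x - (\<phi> x - \<psi> x)) < \<epsilon>"
    using \<epsilon> power_less_imp_less_base[of _ 2 \<epsilon>] by auto
  then show "\<exists>\<phi>\<in>test_functions \<Omega>. Hnorm \<Omega> 1 (\<lambda>x. f x - g x - \<phi> x) < \<epsilon>"
    by (rule bexI[OF _ test_functions_diff[OF \<phi>(1) \<psi>(1)]])
qed

text \<open>Integrating by parts against \<open>x\<^sub>1 \<phi>\<close> gives \<open>\<integral>\<phi>\<^sup>2 = - 2 \<integral>x\<^sub>1 \<phi> \<partial>\<^sub>1\<phi>\<close>.\<close>

lemma Poincare_test_function:
  assumes op: "open \<Omega>" and R: "\<Omega> \<subseteq> cball 0 R" and \<phi>: "\<phi> \<in> test_functions \<Omega>"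
  shows "(L2norm (lebesgue_on \<Omega>) \<phi>)\<^sup>2 \<le> 4 * R\<^sup>2 * (L2norm (lebesgue_on \<Omega>) (pd 1 \<phi>))\<^sup>2"
proof -
  let ?M = "lebesgue_on \<Omega>"
  have T: "(\<lambda>x. x $ 1 * \<phi> x) \<in> test_functions \<Omega>"
    using \<phi> by (intro test_functions_mult_smooth smooth_coord)
  note L = test_functions_L2[OF op \<phi>] test_functions_L2[OF op test_functions_pd[OF \<phi>, of 1]]
    test_functions_L2[OF op T] test_functions_L2[OF op test_functions_pd[OF T, of 1]]
  have pd: "pd 1 (\<lambda>x. x $ 1 * \<phi> x) x = \<phi> x + x $ 1 * pd 1 \<phi> x" for x
    by (subst pd_mult) (auto intro!: smooth_differentiable smooth_coord test_functions_smooth[OF \<phi>] simp: pd_coord)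
  have "(\<integral>x. \<phi> x * pd 1 (\<lambda>x. x $ 1 * \<phi> x) x \<partial>?M) = - (\<integral>x. pd 1 \<phi> x * (x $ 1 * \<phi> x) \<partial>?M)"
    by (rule integral_by_parts_test_functions[OF op \<phi> T])
  moreover have "(\<integral>x. (\<phi> x)\<^sup>2 \<partial>?M) =
      (\<integral>x. \<phi> x * pd 1 (\<lambda>x. x $ 1 * \<phi> x) x - pd 1 \<phi> x * (x $ 1 * \<phi> x) \<partial>?M)"
    unfolding pd by (simp add: algebra_simps power2_eq_square)
  moreover have "\<dots> = (\<integral>x. \<phi> x * pd 1 (\<lambda>x. x $ 1 * \<phi> x) x \<partial>?M) - (\<integral>x. pd 1 \<phi> x * (x $ 1 * \<phi> x) \<partial>?M)"
    using L by (intro Bochner_Integration.integral_diff L2_integrable_mult)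
  ultimately have eq: "(\<integral>x. (\<phi> x)\<^sup>2 \<partial>?M) = (\<integral>x. - 2 * (pd 1 \<phi> x * (x $ 1 * \<phi> x)) \<partial>?M)"
    by simp
  \<comment> \<open>Young's inequality, from the square of
    \<open>\<phi> x + 2 * (x $ 1 * pd 1 \<phi> x)\<close>. The weights leave half of the left side
    to be absorbed, whence the constant \<open>4 * R\<^sup>2\<close>.\<close>
  also have "\<dots> \<le> (\<integral>x. 1 / 2 * (\<phi> x)\<^sup>2 + 2 * R\<^sup>2 * (pd 1 \<phi> x)\<^sup>2 \<partial>?M)"
  proof (rule integral_mono)
    show "integrable ?M (\<lambda>x. - 2 * (pd 1 \<phi> x * (x $ 1 * \<phi> x)))"
      by (intro integrable_mult_right L2_integrable_mult L)
    show "integrable ?M (\<lambda>x. 1 / 2 * (\<phi> x)\<^sup>2 + 2 * R\<^sup>2 * (pd 1 \<phi> x)\<^sup>2)"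
      by (intro Bochner_Integration.integrable_add integrable_mult_right L2_integrable_power2 L)
    fix x assume "x \<in> space ?M"
    then have "norm x \<le> R" using R by auto
    then have "\<bar>x $ 1\<bar> \<le> \<bar>R\<bar>" using component_le_norm_cart[of x 1] by linarith
    then have "(x $ 1)\<^sup>2 \<le> R\<^sup>2" by (rule abs_le_square_iff[THEN iffD1])
    then have "2 * ((x $ 1)\<^sup>2 * (pd 1 \<phi> x)\<^sup>2) \<le> 2 * (R\<^sup>2 * (pd 1 \<phi> x)\<^sup>2)"
      by (simp add: mult_right_mono)
    moreover have "0 \<le> (\<phi> x + 2 * (x $ 1 * pd 1 \<phi> x))\<^sup>2" by simp
    ultimately show "- 2 * (pd 1 \<phi> x * (x $ 1 * \<phi> x)) \<le> 1 / 2 * (\<phi> x)\<^sup>2 + 2 * R\<^sup>2 * (pd 1 \<phi> x)\<^sup>2"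
      by (simp add: power2_sum power_mult_distrib algebra_simps)
  qed
  also have "\<dots> = 1 / 2 * (\<integral>x. (\<phi> x)\<^sup>2 \<partial>?M) + 2 * R\<^sup>2 * (\<integral>x. (pd 1 \<phi> x)\<^sup>2 \<partial>?M)"
    using L[THEN L2_integrable_power2] by simp
  finally show ?thesis by (simp add: L2norm_power2)
qed

text \<open>Closes the density arguments, where the approximation error arrives multiplied by a
  factor that does not depend on \<epsilon>. Dividing by \<open>K + 1\<close> covers
  \<open>K = 0\<close> as well.\<close>

lemma le_if_le_add_mult_epsilon:
  fixes a b K :: real
  assumes "\<And>\<epsilon>. \<epsilon> > 0 \<Longrightarrow> a \<le> b + K * \<epsilon>" "K \<ge> 0"
  shows "a \<le> b"
proof (rule field_le_epsilon)
  fix e :: real assume "e > 0"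
  have "a \<le> b + K * (e / (K + 1))"
    using assms(1)[of "e / (K + 1)"] assms(2) \<open>e > 0\<close> by simp
  also have "K * (e / (K + 1)) \<le> e"
    using assms(2) \<open>e > 0\<close> by (simp add: field_simps)
  finally show "a \<le> b + e" by simp
qed

text \<open>By density from test functions. Passing from \<open>f\<close> to \<phi>, and from the
  derivative of \<phi> back to that of \<open>f\<close>, costs a factor 2 each in squared norms:
  hence 16 instead of 4.\<close>

lemma Poincare_H10:
  assumes op: "open \<Omega>" and R: "\<Omega> \<subseteq> cball 0 R" and f: "f \<in> H10 \<Omega>"
  shows "(L2norm (lebesgue_on \<Omega>) f)\<^sup>2 \<le> 16 * R\<^sup>2 * (L2norm (lebesgue_on \<Omega>) (wpd \<Omega> 1 f))\<^sup>2"
proof (rule le_if_le_add_mult_epsilon)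
  let ?n = "\<lambda>f. (L2norm (lebesgue_on \<Omega>) f)\<^sup>2"
  fix \<epsilon> :: real assume \<epsilon>: "\<epsilon> > 0"
  obtain \<phi> where \<phi>: "\<phi> \<in> test_functions \<Omega>" "(Hnorm \<Omega> 1 (\<lambda>x. f x - \<phi> x))\<^sup>2 < \<epsilon>"
    using H10_approx[OF f \<epsilon>] .
  note H = H10_Hspace[OF f] test_functions_Hspace_1[OF op \<phi>(1)]
  have small: "?n (\<lambda>x. f x - \<phi> x) \<le> \<epsilon>" "?n (wpd \<Omega> 1 (\<lambda>x. f x - \<phi> x)) \<le> \<epsilon>"
    using \<phi>(2) unfolding Hnorm_1_power2[OF op Hspace_1_diff[OF op H]]
    by (smt (verit) zero_le_power2)+
  have "?n f \<le> 2 * ?n (\<lambda>x. f x - \<phi> x) + 2 * ?n (\<lambda>x. - 1 * \<phi> x)"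
    using L2norm_power2_diff_le[OF L2_diff[OF Hspace_L2 Hspace_L2, OF H] L2_cmult[OF Hspace_L2[OF H(2)], of "- 1"]]
    by simp
  also have "?n (\<lambda>x. - 1 * \<phi> x) = ?n \<phi>"
    by (simp add: L2norm_power2)
  finally have 1: "?n f \<le> 2 * ?n (\<lambda>x. f x - \<phi> x) + 2 * ?n \<phi>" .
  have "L2norm (lebesgue_on \<Omega>) (pd 1 \<phi>) = L2norm (lebesgue_on \<Omega>) (wpd \<Omega> 1 \<phi>)"
    using wpd_test_function[OF op \<phi>(1), of 1]
    by (intro L2norm_cong_AE L2_measurable wpd_L2 H test_functions_L2[OF op] test_functions_pd \<phi>(1)) auto
  also have "\<dots> = L2norm (lebesgue_on \<Omega>) (\<lambda>x. wpd \<Omega> 1 f x - (wpd \<Omega> 1 f x - wpd \<Omega> 1 \<phi> x))"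
    by simp
  finally have "?n (pd 1 \<phi>) \<le> 2 * ?n (wpd \<Omega> 1 f) + 2 * ?n (\<lambda>x. wpd \<Omega> 1 f x - wpd \<Omega> 1 \<phi> x)"
    using L2norm_power2_diff_le[OF wpd_L2[OF H(1)] L2_diff[OF wpd_L2[OF H(1)] wpd_L2[OF H(2)]], of 1 1 1]
    by simp
  also have "?n (\<lambda>x. wpd \<Omega> 1 f x - wpd \<Omega> 1 \<phi> x) = ?n (wpd \<Omega> 1 (\<lambda>x. f x - \<phi> x))"
    by (simp add: L2norm_wpd_diff[OF op H])
  finally have "?n (pd 1 \<phi>) \<le> 2 * ?n (wpd \<Omega> 1 f) + 2 * \<epsilon>"
    using small(2) by simp
  then have "4 * R\<^sup>2 * ?n (pd 1 \<phi>) \<le> 4 * R\<^sup>2 * (2 * ?n (wpd \<Omega> 1 f) + 2 * \<epsilon>)"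
    by (rule mult_left_mono) simp
  with 1 small(1) Poincare_test_function[OF op R \<phi>(1)]
  have "?n f \<le> 2 * \<epsilon> + 2 * (4 * R\<^sup>2 * (2 * ?n (wpd \<Omega> 1 f) + 2 * \<epsilon>))"
    by linarith
  then show "?n f \<le> 16 * R\<^sup>2 * ?n (wpd \<Omega> 1 f) + (2 + 16 * R\<^sup>2) * \<epsilon>"
    by (simp add: algebra_simps)
qed simp

text \<open>For a test function in place of \<open>g\<close> both sides equal minus the integral of
  \<open>f\<close> times a mixed second derivative of it, and these commute. Only first derivatives
  of \<open>f\<close> and \<open>g\<close> occur in the claim, so density of test functions in the
  first-order norm suffices for general \<open>g\<close>.\<close>

lemma integral_wpd_wpd_swap:
  assumes op: "open \<Omega>" and f: "f \<in> Hspace \<Omega> 1" and g: "g \<in> H10 \<Omega>"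
  shows "(\<integral>x. wpd \<Omega> i f x * wpd \<Omega> j g x \<partial>lebesgue_on \<Omega>) =
    (\<integral>x. wpd \<Omega> j f x * wpd \<Omega> i g x \<partial>lebesgue_on \<Omega>)"
proof -
  let ?M = "lebesgue_on \<Omega>" and ?n = "\<lambda>f. (L2norm (lebesgue_on \<Omega>) f)\<^sup>2"
  note G = H10_Hspace[OF g]
  have test: "(\<integral>x. wpd \<Omega> i f x * pd j \<phi> x \<partial>?M) = (\<integral>x. wpd \<Omega> j f x * pd i \<phi> x \<partial>?M)"
    if "\<phi> \<in> test_functions \<Omega>" for \<phi>
  proof -
    have "(\<integral>x. f x * pd k (pd l \<phi>) x \<partial>?M) = - (\<integral>x. wpd \<Omega> k f x * pd l \<phi> x \<partial>?M)" for k l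
      using Hspace_1_has_weak_deriv[OF f, of k] test_functions_pd[OF that, of l]
      by (simp add: has_weak_deriv_unit_index)
    from this[of i j] this[of j i] show ?thesis
      by (simp add: pd_commute[OF test_functions_smooth[OF that], of i j])
  qed
  have "\<bar>(\<integral>x. wpd \<Omega> i f x * wpd \<Omega> j g x \<partial>?M) - (\<integral>x. wpd \<Omega> j f x * wpd \<Omega> i g x \<partial>?M)\<bar> \<le>
      0 + (?n (wpd \<Omega> i f) + ?n (wpd \<Omega> j f) + 2) * \<epsilon>" if \<epsilon>: "\<epsilon> > 0" for \<epsilon>
  proof -
    \<comment> \<open>Accuracy \<open>\<epsilon>\<^sup>2\<close> in the squared norm fits Young's
      inequality with weights \<epsilon> and \<open>inverse \<epsilon>\<close>: both resulting terms
      are multiples of \<epsilon>.\<close>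
    obtain \<phi> where \<phi>: "\<phi> \<in> test_functions \<Omega>" "(Hnorm \<Omega> 1 (\<lambda>x. g x - \<phi> x))\<^sup>2 < \<epsilon>\<^sup>2"
      using H10_approx[OF g, of "\<epsilon>\<^sup>2"] \<epsilon> by auto
    note H = test_functions_Hspace_1[OF op \<phi>(1)]
    let ?d = "\<lambda>i. wpd \<Omega> i (\<lambda>x. g x - \<phi> x)"
    have d: "?d i \<in> L2 ?M" for i
      by (intro wpd_L2 Hspace_1_diff op G H)
    have small: "?n (?d i) \<le> \<epsilon>\<^sup>2" for i
      using \<phi>(2) exhaust_2[of i] unfolding Hnorm_1_power2[OF op Hspace_1_diff[OF op G H]]
      by (smt (verit) zero_le_power2)
    have split: "(\<integral>x. wpd \<Omega> k f x * wpd \<Omega> l g x \<partial>?M) =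
        (\<integral>x. wpd \<Omega> k f x * ?d l x \<partial>?M) + (\<integral>x. wpd \<Omega> k f x * pd l \<phi> x \<partial>?M)" for k l
    proof -
      have "(\<integral>x. wpd \<Omega> k f x * wpd \<Omega> l g x \<partial>?M) = (\<integral>x. wpd \<Omega> k f x * ?d l x + wpd \<Omega> k f x * pd l \<phi> x \<partial>?M)"
      proof (rule integral_cong_AE)
        show "AE x in ?M. wpd \<Omega> k f x * wpd \<Omega> l g x = wpd \<Omega> k f x * ?d l x + wpd \<Omega> k f x * pd l \<phi> x"
          using wpd_diff[OF op G H, of l] wpd_test_function[OF op \<phi>(1), of l]
          by eventually_elim (simp flip: distrib_left)
      qed (intro borel_measurable_add borel_measurable_times L2_measurable wpd_L2 f G d
          test_functions_L2[OF op] test_functions_pd \<phi>(1))+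
      also have "\<dots> = (\<integral>x. wpd \<Omega> k f x * ?d l x \<partial>?M) + (\<integral>x. wpd \<Omega> k f x * pd l \<phi> x \<partial>?M)"
        by (intro Bochner_Integration.integral_add L2_integrable_mult wpd_L2 f d
            test_functions_L2[OF op] test_functions_pd \<phi>(1))
      finally show ?thesis .
    qed
    have bound: "\<bar>\<integral>x. wpd \<Omega> k f x * ?d l x \<partial>?M\<bar> \<le> (?n (wpd \<Omega> k f) + 1) * \<epsilon>" for k l
    proof -
      have "\<bar>\<integral>x. wpd \<Omega> k f x * ?d l x \<partial>?M\<bar> \<le> (\<integral>x. \<bar>wpd \<Omega> k f x * ?d l x\<bar> \<partial>?M)"
        by (rule integral_abs_bound)
      also have "\<dots> \<le> (\<integral>x. \<epsilon> * (wpd \<Omega> k f x)\<^sup>2 + inverse \<epsilon> * (?d l x)\<^sup>2 \<partial>?M)"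
      proof (rule integral_mono)
        show "integrable ?M (\<lambda>x. \<bar>wpd \<Omega> k f x * ?d l x\<bar>)"
          by (intro integrable_abs L2_integrable_mult wpd_L2 f d)
        show "integrable ?M (\<lambda>x. \<epsilon> * (wpd \<Omega> k f x)\<^sup>2 + inverse \<epsilon> * (?d l x)\<^sup>2)"
          by (intro Bochner_Integration.integrable_add integrable_mult_right L2_integrable_power2 wpd_L2 f d)
        show "\<bar>wpd \<Omega> k f x * ?d l x\<bar> \<le> \<epsilon> * (wpd \<Omega> k f x)\<^sup>2 + inverse \<epsilon> * (?d l x)\<^sup>2" for x
        proof -
          have "\<bar>a * b\<bar> \<le> \<epsilon> * a\<^sup>2 + inverse \<epsilon> * b\<^sup>2" for a b :: real
          proof -
            have "2 * (\<epsilon> * \<bar>a\<bar>) * \<bar>b\<bar> \<le> (\<epsilon> * \<bar>a\<bar>)\<^sup>2 + \<bar>b\<bar>\<^sup>2"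
              by (rule sum_squares_bound)
            moreover have "0 \<le> \<epsilon> * \<bar>a\<bar> * \<bar>b\<bar>" using \<epsilon> by simp
            ultimately have "\<epsilon> * \<bar>a\<bar> * \<bar>b\<bar> \<le> \<epsilon>\<^sup>2 * a\<^sup>2 + b\<^sup>2"
              by (simp add: power_mult_distrib)
            then show ?thesis
              using \<epsilon> by (simp add: abs_mult field_simps power2_eq_square)
          qed
          then show ?thesis .
        qed
      qed
      also have "\<dots> = \<epsilon> * ?n (wpd \<Omega> k f) + inverse \<epsilon> * ?n (?d l)"
        unfolding L2norm_power2 using L2_integrable_power2[OF d[of l]] L2_integrable_power2[OF wpd_L2[OF f, of k]]
        by simp
      also have "inverse \<epsilon> * ?n (?d l) \<le> inverse \<epsilon> * \<epsilon>\<^sup>2"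
        using \<epsilon> small by (intro mult_left_mono) auto
      also have "inverse \<epsilon> * \<epsilon>\<^sup>2 = \<epsilon>"
        using \<epsilon> by (simp add: power2_eq_square)
      finally show ?thesis by (simp add: algebra_simps)
    qed
    show ?thesis
      unfolding split test[OF \<phi>(1)] using bound[of i j] bound[of j i] by (simp add: algebra_simps)
  qed
  then have "\<bar>(\<integral>x. wpd \<Omega> i f x * wpd \<Omega> j g x \<partial>?M) - (\<integral>x. wpd \<Omega> j f x * wpd \<Omega> i g x \<partial>?M)\<bar> \<le> 0"
    by (rule le_if_le_add_mult_epsilon) (assumption | intro add_nonneg_nonneg zero_le_power2 zero_le_numeral)+
  then show ?thesis by simp
qed

section \<open>Coercivity and the Galerkin error\<close>

text \<open>The integrand \<open>a\<^sub>1\<^sub>2 a\<^sub>2\<^sub>1 - a\<^sub>1\<^sub>1 a\<^sub>2\<^sub>2\<close> integrates to zero for gradients of \<open>H\<^sup>1\<^sub>0\<close> fields. Up to this null Lagrangian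
  the quadratic form of the problem is \<open>\<onehalf>(2w + a\<^sub>1\<^sub>1 + a\<^sub>2\<^sub>2)\<^sup>2 + \<onehalf>\<bar>a\<bar>\<^sup>2\<close>, which is coercive; the mixed terms are
  absorbed by Young's inequality.\<close>

lemma energy_pointwise:
  fixes w a11 a12 a21 a22 x x11 x12 x21 x22 \<rho> :: real
  shows "(w\<^sup>2 + a11\<^sup>2 + a12\<^sup>2 + a21\<^sup>2 + a22\<^sup>2) / 16 \<le>
    \<rho> * w - (2 * (x - w) + ((x11 - a11) + (x22 - a22))) * w
    - ((x11 - a11) * a11 + (x22 - a22) * a22 + ((x12 - a12) + (x21 - a21)) * (a12 + a21) / 2
        + (x - w) * (a11 + a22))
    - (a12 * a21 - a11 * a22)
    + 48 * (x\<^sup>2 + x11\<^sup>2 + x12\<^sup>2 + x21\<^sup>2 + x22\<^sup>2 + \<rho>\<^sup>2)"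
proof -
  \<comment> \<open>Among the products in \<open>?X\<close>, the square of \<open>w\<close> is
    charged most often, five times 1/32, which is below 3/16; so 1/16 of the coercivity constant 1/4
    survives. On the other side \<open>x\<close> is charged most often, four times 8, which is
    within 48.\<close>
  have young: "y * z \<le> z\<^sup>2 / 32 + 8 * y\<^sup>2" for y z :: real
    using zero_le_power2[of "z - 16 * y"] by (simp add: power2_diff power_mult_distrib algebra_simps)
  let ?N = "w\<^sup>2 + a11\<^sup>2 + a12\<^sup>2 + a21\<^sup>2 + a22\<^sup>2"
  let ?B = "(2 * w + (a11 + a22)) * w + a11 * a11 + a22 * a22 + (a12 + a21) * (a12 + a21) / 2 + w * (a11 + a22)
      - (a12 * a21 - a11 * a22)"
  let ?X = "(2 * x + (x11 + x22)) * w + x11 * a11 + x22 * a22 + (x12 + x21) * (a12 + a21) / 2 + x * (a11 + a22)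
      - \<rho> * w"
  \<comment> \<open>A sum-of-squares certificate. Giving up part of the constant 1/2 of the gradient
    terms makes the square of \<open>w\<close> visible on the right as well.\<close>
  have "?B = ?N / 4 + (3 / 8 * (2 * w + (a11 + a22))\<^sup>2 + (w + (a11 + a22))\<^sup>2 / 4 + (a11 - a22)\<^sup>2 / 8
      + a12\<^sup>2 / 4 + a21\<^sup>2 / 4)"
    by (simp add: power2_eq_square field_simps)
  then have "?N / 4 \<le> ?B" by simp
  moreover have "?X \<le> 3 / 16 * ?N + 48 * (x\<^sup>2 + x11\<^sup>2 + x12\<^sup>2 + x21\<^sup>2 + x22\<^sup>2 + \<rho>\<^sup>2)"
  proof -
    have "?X = 2 * (x * w) + x11 * w + x22 * w + (- \<rho>) * w + x11 * a11 + x22 * a22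
        + (x12 * a12 + x12 * a21 + x21 * a12 + x21 * a21) / 2 + x * a11 + x * a22"
      by (simp add: field_simps)
    also have "\<dots> \<le> 3 / 16 * ?N + 48 * (x\<^sup>2 + x11\<^sup>2 + x12\<^sup>2 + x21\<^sup>2 + x22\<^sup>2 + \<rho>\<^sup>2)"
      using young[of x w] young[of x11 w] young[of x22 w] young[of "- \<rho>" w] young[of x11 a11] young[of x22 a22]
        young[of x12 a12] young[of x12 a21] young[of x21 a12] young[of x21 a21] young[of x a11] young[of x a22]
        zero_le_power2[of w] zero_le_power2[of a11] zero_le_power2[of a12] zero_le_power2[of a21]
        zero_le_power2[of a22] zero_le_power2[of x] zero_le_power2[of x11] zero_le_power2[of x12]
        zero_le_power2[of x21] zero_le_power2[of x22] zero_le_power2[of \<rho>]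
      unfolding power2_minus distrib_left add_divide_distrib by linarith
    finally show ?thesis .
  qed
  moreover have "\<rho> * w - (2 * (x - w) + ((x11 - a11) + (x22 - a22))) * w
      - ((x11 - a11) * a11 + (x22 - a22) * a22 + ((x12 - a12) + (x21 - a21)) * (a12 + a21) / 2
          + (x - w) * (a11 + a22)) - (a12 * a21 - a11 * a22) = ?B - ?X"
    by (simp add: field_simps)
  ultimately show ?thesis by linarith
qed

lemma integrable_momentum_form:
  assumes "e \<in> L2 M" "e11 \<in> L2 M" "e12 \<in> L2 M" "e21 \<in> L2 M" "e22 \<in> L2 M"
    "t11 \<in> L2 M" "t12 \<in> L2 M" "t21 \<in> L2 M" "t22 \<in> L2 M"
  shows "integrable M (\<lambda>s. e11 s * t11 s + e22 s * t22 s + (e12 s + e21 s) * (t12 s + t21 s) / 2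
    + e s * (t11 s + t22 s))"
  by (intro Bochner_Integration.integrable_add integrable_divide_zero L2_integrable_mult L2_add assms)

text \<open>In the application \<open>w\<close> and \<open>a\<close> are the pressure and the
  gradient of the discrete solution minus a discrete competitor, \<open>x\<close> and
  \<open>x11\<close> to \<open>x22\<close> those of the exact solution minus the same competitor,
  and \<rho> is the data error; the differences \<open>x - w\<close> and so on are then the Galerkin
  errors. After integration \<open>mass\<close>, \<open>momentum\<close> and \<open>swap\<close>
  cancel every indefinite term of the pointwise inequality. The constant is 16 times 48.\<close>

lemma energy_estimate:
  assumes L: "w \<in> L2 M" "a11 \<in> L2 M" "a12 \<in> L2 M" "a21 \<in> L2 M" "a22 \<in> L2 M"
    "x \<in> L2 M" "x11 \<in> L2 M" "x12 \<in> L2 M" "x21 \<in> L2 M" "x22 \<in> L2 M" "\<rho> \<in> L2 M"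
    and mass: "(\<integral>s. (2 * (x s - w s) + ((x11 s - a11 s) + (x22 s - a22 s))) * w s \<partial>M) = (\<integral>s. \<rho> s * w s \<partial>M)"
    and momentum: "(\<integral>s. (x11 s - a11 s) * a11 s + (x22 s - a22 s) * a22 s
        + ((x12 s - a12 s) + (x21 s - a21 s)) * (a12 s + a21 s) / 2 + (x s - w s) * (a11 s + a22 s) \<partial>M) = 0"
    and swap: "(\<integral>s. a12 s * a21 s \<partial>M) = (\<integral>s. a11 s * a22 s \<partial>M)"
  shows "(L2norm M w)\<^sup>2 + (L2norm M a11)\<^sup>2 + (L2norm M a12)\<^sup>2 + (L2norm M a21)\<^sup>2 + (L2norm M a22)\<^sup>2 \<le>
    768 * ((L2norm M x)\<^sup>2 + (L2norm M x11)\<^sup>2 + (L2norm M x12)\<^sup>2 + (L2norm M x21)\<^sup>2 + (L2norm M x22)\<^sup>2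
      + (L2norm M \<rho>)\<^sup>2)"
proof -
  note sq = L[THEN L2_integrable_power2]
  let ?mass = "\<lambda>s. (2 * (x s - w s) + ((x11 s - a11 s) + (x22 s - a22 s))) * w s"
  let ?mom = "\<lambda>s. (x11 s - a11 s) * a11 s + (x22 s - a22 s) * a22 s
        + ((x12 s - a12 s) + (x21 s - a21 s)) * (a12 s + a21 s) / 2 + (x s - w s) * (a11 s + a22 s)"
  let ?l = "\<lambda>s. ((w s)\<^sup>2 + (a11 s)\<^sup>2 + (a12 s)\<^sup>2 + (a21 s)\<^sup>2 + (a22 s)\<^sup>2) / 16"
  let ?r = "\<lambda>s. 48 * ((x s)\<^sup>2 + (x11 s)\<^sup>2 + (x12 s)\<^sup>2 + (x21 s)\<^sup>2 + (x22 s)\<^sup>2 + (\<rho> s)\<^sup>2)"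
  have int: "integrable M (\<lambda>s. \<rho> s * w s)" "integrable M ?mass" "integrable M ?mom"
    "integrable M (\<lambda>s. a12 s * a21 s)" "integrable M (\<lambda>s. a11 s * a22 s)"
    by (intro L2_integrable_mult L2_add L2_diff L2_cmult integrable_momentum_form L)+
  have intlr: "integrable M ?l" "integrable M ?r"
    by (intro integrable_divide_zero integrable_mult_right Bochner_Integration.integrable_add sq)+
  have "(\<integral>s. ?l s \<partial>M) \<le> (\<integral>s. \<rho> s * w s - ?mass s - ?mom s - (a12 s * a21 s - a11 s * a22 s) + ?r s \<partial>M)"
    by (intro integral_mono energy_pointwise intlr Bochner_Integration.integrable_add
        Bochner_Integration.integrable_diff int)
  also have "\<dots> = (\<integral>s. \<rho> s * w s \<partial>M) - (\<integral>s. ?mass s \<partial>M) - (\<integral>s. ?mom s \<partial>M)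
      - ((\<integral>s. a12 s * a21 s \<partial>M) - (\<integral>s. a11 s * a22 s \<partial>M)) + (\<integral>s. ?r s \<partial>M)"
    by (simp only: Bochner_Integration.integral_add Bochner_Integration.integral_diff
        Bochner_Integration.integrable_add Bochner_Integration.integrable_diff int intlr)
  also have "\<dots> = (\<integral>s. ?r s \<partial>M)"
    unfolding mass momentum swap by simp
  finally show ?thesis
    using sq by (simp add: L2norm_power2)
qed

section \<open>The Galerkin error in squared norms\<close>

lemma symgrad_inner:
  "symgrad \<Omega> u x \<bullet> symgrad \<Omega> z x =
    wpd \<Omega> 1 (\<lambda>y. u y $ 1) x * wpd \<Omega> 1 (\<lambda>y. z y $ 1) x
    + wpd \<Omega> 2 (\<lambda>y. u y $ 2) x * wpd \<Omega> 2 (\<lambda>y. z y $ 2) x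
    + (wpd \<Omega> 2 (\<lambda>y. u y $ 1) x + wpd \<Omega> 1 (\<lambda>y. u y $ 2) x)
      * (wpd \<Omega> 2 (\<lambda>y. z y $ 1) x + wpd \<Omega> 1 (\<lambda>y. z y $ 2) x) / 2"
  by (simp add: symgrad_def wjacobian_def transpose_def inner_vec_def sum_2 field_simps)

lemma vHnorm_power2: "(vHnorm \<Omega> m v)\<^sup>2 = (Hnorm \<Omega> m (\<lambda>x. v x $ 1))\<^sup>2 + (Hnorm \<Omega> m (\<lambda>x. v x $ 2))\<^sup>2"
  by (simp add: vHnorm_def sum_2)

lemma vHnorm_nonneg: "0 \<le> vHnorm \<Omega> m v"
  by (simp add: vHnorm_def sum_nonneg)

lemma L20_L2: "q \<in> L20 \<Omega> \<Longrightarrow> q \<in> L2 (lebesgue_on \<Omega>)"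
  by (simp add: L20_def)

text \<open>By conformity the discrete test functions are admissible in both problems. Subtraction
  leaves error equations whose only defect is \<open>r - rh\<close> in the first one. They are
  tested with the discrete solution minus an arbitrary competitor \<open>(q, z)\<close>, and the
  error itself is recovered by passing through the competitor.\<close>

lemma Galerkin_error_power2:
  assumes op: "open \<Omega>" and R: "\<Omega> \<subseteq> cball 0 R"
    and Q: "Q \<subseteq> L20 \<Omega>" and U: "U \<subseteq> vec_space (H10 \<Omega>)"
    and r: "r \<in> L2 (lebesgue_on \<Omega>)" and rh: "rh \<in> L2 (lebesgue_on \<Omega>)"
    and cont: "auxiliary_pair \<Omega> (L20 \<Omega>) (vec_space (H10 \<Omega>)) r p u"
    and disc: "auxiliary_pair \<Omega> Q U rh ph uh"
    and q: "q \<in> Q" and z: "z \<in> U"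
  shows "(L2norm (lebesgue_on \<Omega>) (\<lambda>x. p x - ph x))\<^sup>2 + (vHnorm \<Omega> 1 (\<lambda>x. u x - uh x))\<^sup>2 \<le>
    (1 + 16 * R\<^sup>2) * 1538 * ((L2norm (lebesgue_on \<Omega>) (\<lambda>x. p x - q x))\<^sup>2 + (vHnorm \<Omega> 1 (\<lambda>x. u x - z x))\<^sup>2
      + (L2norm (lebesgue_on \<Omega>) (\<lambda>x. r x - rh x))\<^sup>2)"
proof -
  let ?M = "lebesgue_on \<Omega>"
  let ?D = "\<lambda>i j v. wpd \<Omega> j (\<lambda>y. v y $ i)"
  let ?n = "\<lambda>f. (L2norm ?M f)\<^sup>2"
  have ph: "ph \<in> Q" and uh: "uh \<in> U" and pL: "p \<in> L20 \<Omega>" and uV: "u \<in> vec_space (H10 \<Omega>)"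
    using cont disc by (auto simp: auxiliary_pair_def)
  have L: "p \<in> L2 ?M" "ph \<in> L2 ?M" "q \<in> L2 ?M"
    using pL ph q Q by (auto intro: L20_L2)
  have V: "(\<lambda>y. u y $ i) \<in> H10 \<Omega>" "(\<lambda>y. uh y $ i) \<in> H10 \<Omega>" "(\<lambda>y. z y $ i) \<in> H10 \<Omega>" for i
    using uV uh z U by (auto simp: vec_space_def)
  note DL = wpd_L2[OF H10_Hspace[OF V(1)]] wpd_L2[OF H10_Hspace[OF V(2)]] wpd_L2[OF H10_Hspace[OF V(3)]]
  have mass: "(\<integral>x. (2 * (p x - ph x) + ((?D 1 1 u x - ?D 1 1 uh x) + (?D 2 2 u x - ?D 2 2 uh x))) * t x \<partial>?M)
      = (\<integral>x. (r x - rh x) * t x \<partial>?M)" if "t \<in> Q" for t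
  proof -
    have t: "t \<in> L20 \<Omega>" "t \<in> L2 ?M" using that Q by (auto intro: L20_L2)
    let ?m = "\<lambda>p u x. 2 * p x + (?D 1 1 u x + ?D 2 2 u x)"
    have int: "integrable ?M (\<lambda>x. ?m p u x * t x)" "integrable ?M (\<lambda>x. ?m ph uh x * t x)"
      "integrable ?M (\<lambda>x. r x * t x)" "integrable ?M (\<lambda>x. rh x * t x)"
      by (intro L2_integrable_mult L2_add L2_cmult L DL t r rh)+
    have "(\<integral>x. ?m p u x * t x \<partial>?M) = (\<integral>x. r x * t x \<partial>?M)" "(\<integral>x. ?m ph uh x * t x \<partial>?M) = (\<integral>x. rh x * t x \<partial>?M)"
      using cont disc that t(1) by (simp_all add: auxiliary_pair_def L2inner_def wdiv_def sum_2)
    then have "(\<integral>x. ?m p u x * t x - ?m ph uh x * t x \<partial>?M) = (\<integral>x. r x * t x - rh x * t x \<partial>?M)"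
      by (simp only: Bochner_Integration.integral_diff int)
    then show ?thesis by (simp add: algebra_simps)
  qed
  let ?S = "\<lambda>e e11 e12 e21 e22 t11 t12 t21 t22 s. e11 s * t11 s + e22 s * t22 s
    + (e12 s + e21 s) * (t12 s + t21 s) / 2 + e s * (t11 s + t22 s) :: real"
  let ?E = "\<lambda>i j x. ?D i j u x - ?D i j uh x"
  have momentum: "(\<integral>x. ?S (\<lambda>x. p x - ph x) (?E 1 1) (?E 1 2) (?E 2 1) (?E 2 2)
      (?D 1 1 v) (?D 1 2 v) (?D 2 1 v) (?D 2 2 v) x \<partial>?M) = 0" if v: "v \<in> U" for v
  proof -
    let ?T = "\<lambda>p u. ?S p (?D 1 1 u) (?D 1 2 u) (?D 2 1 u) (?D 2 2 u) (?D 1 1 v) (?D 1 2 v) (?D 2 1 v) (?D 2 2 v)"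
    have vV: "v \<in> vec_space (H10 \<Omega>)" "(\<lambda>y. v y $ i) \<in> H10 \<Omega>" for i
      using v U by (auto simp: vec_space_def)
    note DLv = wpd_L2[OF H10_Hspace[OF vV(2)]]
    have eq: "(\<integral>x. ?T f g x \<partial>?M) = L2inner \<Omega> (symgrad \<Omega> g) (symgrad \<Omega> v) + L2inner \<Omega> f (wdiv \<Omega> v)"
      if "f \<in> L2 ?M" "\<And>i j. ?D i j g \<in> L2 ?M" for f g
    proof -
      have "integrable ?M (\<lambda>x. symgrad \<Omega> g x \<bullet> symgrad \<Omega> v x)" "integrable ?M (\<lambda>x. f x \<bullet> wdiv \<Omega> v x)"
        unfolding symgrad_inner wdiv_def sum_2 inner_real_def
        by (intro Bochner_Integration.integrable_add integrable_divide_zero L2_integrable_mult L2_add that DLv)+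
      then show ?thesis
        unfolding L2inner_def
        by (subst Bochner_Integration.integral_add[symmetric]) (simp_all add: symgrad_inner wdiv_def sum_2)
    qed
    have "(\<integral>x. ?T p u x \<partial>?M) = 0" "(\<integral>x. ?T ph uh x \<partial>?M) = 0"
      using cont disc v vV(1) by (simp_all add: eq L DL auxiliary_pair_def)
    moreover have "integrable ?M (?T p u)" "integrable ?M (?T ph uh)"
      by (intro integrable_momentum_form L DL DLv)+
    ultimately have "(\<integral>x. ?T p u x - ?T ph uh x \<partial>?M) = 0"
      by (simp only: Bochner_Integration.integral_diff)
    also have "(\<lambda>x. ?T p u x - ?T ph uh x) = ?S (\<lambda>x. p x - ph x) (?E 1 1) (?E 1 2) (?E 2 1) (?E 2 2)
      (?D 1 1 v) (?D 1 2 v) (?D 2 1 v) (?D 2 2 v)"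
      by (simp add: fun_eq_iff field_simps)
    finally show ?thesis .
  qed
  define w where "w = (\<lambda>x. ph x - q x)"
  \<comment> \<open>Differences of derivatives rather than derivatives of differences: in this form
    the error equations hold verbatim, with no change on null sets.\<close>
  define a where "a = (\<lambda>i j x. ?D i j uh x - ?D i j z x)"
  define X where "X = (\<lambda>i j x. ?D i j u x - ?D i j z x)"
  have aL: "a i j \<in> L2 ?M" and XL: "X i j \<in> L2 ?M" and wL: "w \<in> L2 ?M" and EL: "?E i j \<in> L2 ?M" for i j
    unfolding a_def X_def w_def by (intro L2_diff L DL)+
  have E_eq: "?D i j u x - ?D i j uh x = X i j x - a i j x" and e_eq: "p x - ph x = (p x - q x) - w x" for i j x
    by (simp_all add: X_def a_def w_def)
  have N: "?n w + ?n (a 1 1) + ?n (a 1 2) + ?n (a 2 1) + ?n (a 2 2) \<le>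
    768 * (?n (\<lambda>x. p x - q x) + ?n (X 1 1) + ?n (X 1 2) + ?n (X 2 1) + ?n (X 2 2) + ?n (\<lambda>x. r x - rh x))"
  proof (rule energy_estimate)
    let ?F = "\<lambda>x. 2 * (p x - ph x) + (?E 1 1 x + ?E 2 2 x)"
    have int: "integrable ?M (\<lambda>x. ?F x * t x)" "integrable ?M (\<lambda>x. (r x - rh x) * t x)" if "t \<in> L2 ?M" for t
      by (intro L2_integrable_mult L2_add L2_cmult L2_diff L DL r rh that)+
    \<comment> \<open>\<open>Q\<close> and \<open>U\<close> are mere subsets here, so the
      differences themselves are not known to be admissible. The equation is taken for
      \<open>ph\<close> and for \<open>q\<close> and then subtracted; likewise below for
      \<open>uh\<close> and \<open>z\<close>.\<close>
    have "(\<integral>x. ?F x * ph x - ?F x * q x \<partial>?M) = (\<integral>x. (r x - rh x) * ph x - (r x - rh x) * q x \<partial>?M)"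
      by (simp only: Bochner_Integration.integral_diff int L mass ph q)
    then have "(\<integral>x. ?F x * w x \<partial>?M) = (\<integral>x. (r x - rh x) * w x \<partial>?M)"
      by (simp only: w_def right_diff_distrib)
    then show "(\<integral>x. (2 * ((p x - q x) - w x) + ((X 1 1 x - a 1 1 x) + (X 2 2 x - a 2 2 x))) * w x \<partial>?M)
        = (\<integral>x. (r x - rh x) * w x \<partial>?M)"
      by (simp only: E_eq e_eq)
    let ?T = "\<lambda>v. ?S (\<lambda>x. p x - ph x) (?E 1 1) (?E 1 2) (?E 2 1) (?E 2 2)
      (?D 1 1 v) (?D 1 2 v) (?D 2 1 v) (?D 2 2 v)"
    have intT: "integrable ?M (?T uh)" "integrable ?M (?T z)"
      by (intro integrable_momentum_form L2_diff L DL)+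
    have "(\<integral>x. ?T uh x - ?T z x \<partial>?M) = 0"
      by (simp only: Bochner_Integration.integral_diff intT momentum uh z)
    also have "(\<lambda>x. ?T uh x - ?T z x) = (\<lambda>x. (X 1 1 x - a 1 1 x) * a 1 1 x + (X 2 2 x - a 2 2 x) * a 2 2 x
        + ((X 1 2 x - a 1 2 x) + (X 2 1 x - a 2 1 x)) * (a 1 2 x + a 2 1 x) / 2
        + ((p x - q x) - w x) * (a 1 1 x + a 2 2 x))"
      unfolding a_def X_def w_def by (simp add: fun_eq_iff field_simps)
    finally show "(\<integral>x. (X 1 1 x - a 1 1 x) * a 1 1 x + (X 2 2 x - a 2 2 x) * a 2 2 x
        + ((X 1 2 x - a 1 2 x) + (X 2 1 x - a 2 1 x)) * (a 1 2 x + a 2 1 x) / 2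
        + ((p x - q x) - w x) * (a 1 1 x + a 2 2 x) \<partial>?M) = 0" .
    \<comment> \<open>The exchange of derivatives concerns the weak derivatives of the field
      \<open>uh - z\<close>, which agree with \<open>a\<close> only almost everywhere.\<close>
    have ae: "AE x in ?M. wpd \<Omega> j (\<lambda>y. uh y $ i - z y $ i) x = a i j x" for i j
      unfolding a_def by (rule wpd_diff[OF op H10_Hspace[OF V(2)] H10_Hspace[OF V(3)]])
    have dL: "wpd \<Omega> j (\<lambda>y. uh y $ i - z y $ i) \<in> L2 ?M" for i j
      by (intro wpd_L2 H10_Hspace H10_diff op V)
    have cong: "(\<integral>x. wpd \<Omega> j (\<lambda>y. uh y $ i - z y $ i) x * wpd \<Omega> l (\<lambda>y. uh y $ k - z y $ k) x \<partial>?M) =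
        (\<integral>x. a i j x * a k l x \<partial>?M)" for i j k l
    proof (rule integral_cong_AE)
      show "AE x in ?M. wpd \<Omega> j (\<lambda>y. uh y $ i - z y $ i) x * wpd \<Omega> l (\<lambda>y. uh y $ k - z y $ k) x = a i j x * a k l x"
        using ae[of j i] ae[of l k] by eventually_elim simp
    qed (intro borel_measurable_times L2_measurable dL aL)+
    show "(\<integral>x. a 1 2 x * a 2 1 x \<partial>?M) = (\<integral>x. a 1 1 x * a 2 2 x \<partial>?M)"
      unfolding cong[symmetric]
      by (rule integral_wpd_wpd_swap[OF op H10_Hspace[OF H10_diff[OF op V(2,3)]] H10_diff[OF op V(2,3)]])
  qed (intro aL XL wL L2_diff L r rh)+
  have E: "?n (?E i j) \<le> 2 * ?n (X i j) + 2 * ?n (a i j)" for i j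
    unfolding E_eq by (rule L2norm_power2_diff_le[OF XL aL])
  have e: "?n (\<lambda>x. p x - ph x) \<le> 2 * ?n (\<lambda>x. p x - q x) + 2 * ?n w"
    unfolding e_eq by (rule L2norm_power2_diff_le[OF L2_diff[OF L(1,3)] wL])
  have vz: "(vHnorm \<Omega> 1 (\<lambda>x. u x - z x))\<^sup>2 \<ge> ?n (X 1 1) + ?n (X 1 2) + ?n (X 2 1) + ?n (X 2 2)"
  proof -
    have "(Hnorm \<Omega> 1 (\<lambda>y. u y $ i - z y $ i))\<^sup>2 = ?n (\<lambda>y. u y $ i - z y $ i) + ?n (X i 1) + ?n (X i 2)" for i
      unfolding X_def by (simp only: Hnorm_1_power2 L2norm_wpd_diff op Hspace_1_diff H10_Hspace V)
    then show ?thesis by (simp add: vHnorm_power2)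
  qed
  \<comment> \<open>The components of the error lie in \<open>H10\<close>, so Poincare's inequality
    bounds their zeroth-order part by the gradient, which accounts for the factor.\<close>
  have vuh: "(vHnorm \<Omega> 1 (\<lambda>x. u x - uh x))\<^sup>2 \<le>
      (1 + 16 * R\<^sup>2) * (?n (?E 1 1) + ?n (?E 1 2) + ?n (?E 2 1) + ?n (?E 2 2))"
  proof -
    have "(Hnorm \<Omega> 1 (\<lambda>y. u y $ i - uh y $ i))\<^sup>2 \<le> (1 + 16 * R\<^sup>2) * (?n (?E i 1) + ?n (?E i 2))" for i
    proof -
      have "?n (\<lambda>y. u y $ i - uh y $ i) \<le> 16 * R\<^sup>2 * ?n (?E i 1)"
        using Poincare_H10[OF op R H10_diff[OF op V(1,2)], of i i]
        by (simp only: L2norm_wpd_diff op H10_Hspace V)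
      moreover have "(Hnorm \<Omega> 1 (\<lambda>y. u y $ i - uh y $ i))\<^sup>2 = ?n (\<lambda>y. u y $ i - uh y $ i) + ?n (?E i 1) + ?n (?E i 2)"
        by (simp only: Hnorm_1_power2 L2norm_wpd_diff op Hspace_1_diff H10_Hspace V)
      moreover have "0 \<le> 16 * R\<^sup>2 * ?n (?E i 2)" by simp
      ultimately show ?thesis unfolding distrib_right distrib_left mult_1 by linarith
    qed
    from this[of 1] this[of 2] show ?thesis
      by (simp add: vHnorm_power2 algebra_simps)
  qed
  have "?n (\<lambda>x. p x - ph x) \<le> (1 + 16 * R\<^sup>2) * ?n (\<lambda>x. p x - ph x)"
    by (simp add: mult_le_cancel_right1)
  with vuh have 2: "?n (\<lambda>x. p x - ph x) + (vHnorm \<Omega> 1 (\<lambda>x. u x - uh x))\<^sup>2 \<le> (1 + 16 * R\<^sup>2) *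
      (?n (\<lambda>x. p x - ph x) + (?n (?E 1 1) + ?n (?E 1 2) + ?n (?E 2 1) + ?n (?E 2 2)))"
    by (subst distrib_left) linarith
  \<comment> \<open>The constant is 2 + 2 * 768: the error is split at the competitor, which doubles
    both parts, and the discrete part obeys \<open>N\<close>.\<close>
  have "?n (\<lambda>x. p x - ph x) + (?n (?E 1 1) + ?n (?E 1 2) + ?n (?E 2 1) + ?n (?E 2 2)) \<le>
      1538 * (?n (\<lambda>x. p x - q x) + (vHnorm \<Omega> 1 (\<lambda>x. u x - z x))\<^sup>2 + ?n (\<lambda>x. r x - rh x))"
    using N e vz E[of 1 1] E[of 1 2] E[of 2 1] E[of 2 2] zero_le_power2[of "L2norm ?M (\<lambda>x. r x - rh x)"]
    by argo
  then have "(1 + 16 * R\<^sup>2) * (?n (\<lambda>x. p x - ph x) + (?n (?E 1 1) + ?n (?E 1 2) + ?n (?E 2 1) + ?n (?E 2 2))) \<le>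
      (1 + 16 * R\<^sup>2) * (1538 * (?n (\<lambda>x. p x - q x) + (vHnorm \<Omega> 1 (\<lambda>x. u x - z x))\<^sup>2 + ?n (\<lambda>x. r x - rh x)))"
    by (rule mult_left_mono) simp
  with 2 show ?thesis by (simp only: mult.assoc)
qed

text \<open>The return from squared norms to norms; the factor 2 under the root comes from
  \<open>(a + b)\<^sup>2 \<le> 2 * (a\<^sup>2 + b\<^sup>2)\<close>.\<close>

lemma sum_le_sqrt_mult_sum:
  fixes a b x y z K :: real
  assumes "a\<^sup>2 + b\<^sup>2 \<le> K * (x\<^sup>2 + y\<^sup>2 + z\<^sup>2)" "K \<ge> 0" "x \<ge> 0" "y \<ge> 0" "z \<ge> 0"
  shows "a + b \<le> sqrt (2 * K) * (x + y + z)"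
proof (rule power2_le_imp_le)
  have "(a + b)\<^sup>2 \<le> 2 * (a\<^sup>2 + b\<^sup>2)"
    using zero_le_power2[of "a - b"] by (simp add: power2_sum power2_diff)
  also have "\<dots> \<le> 2 * K * (x\<^sup>2 + y\<^sup>2 + z\<^sup>2)" using assms(1) by simp
  also have "\<dots> \<le> 2 * K * (x + y + z)\<^sup>2"
  proof (rule mult_left_mono)
    have "0 \<le> x * y" "0 \<le> y * z" "0 \<le> x * z" using assms by simp_all
    then show "x\<^sup>2 + y\<^sup>2 + z\<^sup>2 \<le> (x + y + z)\<^sup>2" by (simp add: power2_eq_square algebra_simps)
  qed (use assms in simp)
  finally show "(a + b)\<^sup>2 \<le> (sqrt (2 * K) * (x + y + z))\<^sup>2"
    using assms by (simp add: power_mult_distrib)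
qed (use assms in simp)

text \<open>The two infima are taken one after the other: for fixed \<open>z\<close> the bound is
  solved for the distance to \<open>q\<close>, and what remains is solved for the distance to
  \<open>z\<close>.\<close>

lemma le_best_approximation:
  assumes "Q \<noteq> {}" "U \<noteq> {}" "C > 0"
    and "\<And>q z. q \<in> Q \<Longrightarrow> z \<in> U \<Longrightarrow>
      e \<le> C * (L2norm (lebesgue_on \<Omega>) (\<lambda>x. p x - q x) + vHnorm \<Omega> 1 (\<lambda>x. u x - z x) + \<eta>)"
  shows "e \<le> C * (best_p \<Omega> Q p + best_u \<Omega> U u + \<eta>)"
proof -
  have "e / C - \<eta> - vHnorm \<Omega> 1 (\<lambda>x. u x - z x) \<le> best_p \<Omega> Q p" if "z \<in> U" for z
    unfolding best_p_def using assms that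
    by (intro cINF_greatest) (auto simp: field_simps)
  then have "e / C - \<eta> - best_p \<Omega> Q p \<le> vHnorm \<Omega> 1 (\<lambda>x. u x - z x)" if "z \<in> U" for z
    using that by fastforce
  then have "e / C - \<eta> - best_p \<Omega> Q p \<le> best_u \<Omega> U u"
    unfolding best_u_def using assms(2) by (intro cINF_greatest)
  then have "e / C \<le> best_p \<Omega> Q p + best_u \<Omega> U u + \<eta>" by simp
  then show ?thesis using assms(3) by (simp add: field_simps)
qed

lemma wlaplace_L2:
  assumes "c \<in> Hspace \<Omega> 2"
  shows "wlaplace \<Omega> c \<in> L2 (lebesgue_on \<Omega>)"
proof -
  have "wderiv \<Omega> (\<lambda>j. if j = i then 2 else 0) c \<in> L2 (lebesgue_on \<Omega>)" for i
  proof -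
    have "order_of (\<lambda>j. if j = i then 2 else 0) \<le> 2"
      by (simp add: order_of_def)
    with assms obtain g where "has_weak_deriv \<Omega> (\<lambda>j. if j = i then 2 else 0) c g"
      unfolding Hspace_def by blast
    then show ?thesis
      by (intro has_weak_deriv_L2[OF has_weak_deriv_wderiv])
  qed
  from L2_add[OF this[of 1] this[of 2]] show ?thesis
    by (simp add: wlaplace_def[abs_def] sum_2)
qed

theorem theorem6p3:
  fixes \<Omega> :: "(real^2) set" and H :: "real set" and \<T> :: "real \<Rightarrow> (real^2) set set"
    and rc rp ru :: nat
  assumes "convex_polygonal_domain \<Omega>"
    and "mesh_family \<Omega> H \<T>"
    and "rc \<ge> 1" "rp \<ge> 1" "ru \<ge> 1"
    and approx_p: "\<exists>C. \<forall>h\<in>H. \<forall>q \<in> Hspace \<Omega> (rp + 1) \<inter> L20 \<Omega>.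
          best_p \<Omega> (Qh \<Omega> (\<T> h) rp) q \<le> C * h ^ (rp + 1) * Hnorm \<Omega> (rp + 1) q"
    and approx_u: "\<exists>C. \<forall>h\<in>H. \<forall>z \<in> vec_space (Hspace \<Omega> (ru + 1)) \<inter> vec_space (H10 \<Omega>).
          best_u \<Omega> (Uh \<Omega> (\<T> h) ru) z \<le> C * h ^ ru * vHnorm \<Omega> (ru + 1) z"
  shows "\<exists>C>0. \<forall>c r p u.
      c \<in> Hspace \<Omega> 2 \<and> zero_normal_deriv \<Omega> c \<and> r = (\<lambda>x. - wlaplace \<Omega> c x) \<and>
      auxiliary_pair \<Omega> (L20 \<Omega>) (vec_space (H10 \<Omega>)) r p u \<and>
      p \<in> Hspace \<Omega> (rp + 1) \<inter> L20 \<Omega> \<and>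
      u \<in> vec_space (Hspace \<Omega> (ru + 1)) \<inter> vec_space (H10 \<Omega>) \<longrightarrow>
      (\<forall>h\<in>H. \<forall>ch rh ph uh.
        ch \<in> Lagrange \<Omega> (\<T> h) rc \<and>
        discrete_neg_laplacian \<Omega> (Qh \<Omega> (\<T> h) rp) ch rh \<and>
        auxiliary_pair \<Omega> (Qh \<Omega> (\<T> h) rp) (Uh \<Omega> (\<T> h) ru) rh ph uh \<longrightarrow>
        L2norm (lebesgue_on \<Omega>) (\<lambda>x. p x - ph x) + vHnorm \<Omega> 1 (\<lambda>x. u x - uh x)
          \<le> C * (best_p \<Omega> (Qh \<Omega> (\<T> h) rp) p + best_u \<Omega> (Uh \<Omega> (\<T> h) ru) u
                 + L2norm (lebesgue_on \<Omega>) (\<lambda>x. r x - rh x)) \<and>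
        L2norm (lebesgue_on \<Omega>) (\<lambda>x. p x - ph x) + vHnorm \<Omega> 1 (\<lambda>x. u x - uh x)
          \<le> C * (h ^ (rp + 1) * Hnorm \<Omega> (rp + 1) p + h ^ ru * vHnorm \<Omega> (ru + 1) u
                 + L2norm (lebesgue_on \<Omega>) (\<lambda>x. r x - rh x)))"
proof -
  have op: "open \<Omega>" and bounded: "bounded \<Omega>"
    using assms(1) by (simp_all add: convex_polygonal_domain_def)
  obtain R where R: "\<Omega> \<subseteq> cball 0 R"
    using bounded_subset_ballD[OF bounded, of 0] ball_subset_cball by (meson subset_trans)
  obtain C1 where C1: "\<forall>h\<in>H. \<forall>q \<in> Hspace \<Omega> (rp + 1) \<inter> L20 \<Omega>.
      best_p \<Omega> (Qh \<Omega> (\<T> h) rp) q \<le> C1 * h ^ (rp + 1) * Hnorm \<Omega> (rp + 1) q"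
    using approx_p ..
  obtain C2 where C2: "\<forall>h\<in>H. \<forall>z \<in> vec_space (Hspace \<Omega> (ru + 1)) \<inter> vec_space (H10 \<Omega>).
      best_u \<Omega> (Uh \<Omega> (\<T> h) ru) z \<le> C2 * h ^ ru * vHnorm \<Omega> (ru + 1) z"
    using approx_u ..
  \<comment> \<open>One constant has to serve both estimates: \<open>C0\<close> suffices for the
    first, and the second brings in the approximation constants, in absolute value because their
    sign is not assumed. All depend on \<open>R\<close>, \<open>C1\<close> and \<open>C2\<close>
    only and are fixed before the mesh index and the data.\<close>
  define K where "K = (1 + 16 * R\<^sup>2) * 1538"
  define C0 where "C0 = sqrt (2 * K)"
  define C where "C = C0 * (1 + \<bar>C1\<bar> + \<bar>C2\<bar>)"
  have K: "K > 0"
    unfolding K_def by (intro mult_pos_pos add_pos_nonneg) simp_all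
  then have C0: "C0 > 0" by (simp add: C0_def)
  then have C0_le: "C0 \<le> C" and C: "C > 0"
    by (simp_all add: C_def mult_le_cancel_left1 mult_pos_pos add_pos_nonneg)
  let ?M = "lebesgue_on \<Omega>"
  show ?thesis
  proof (intro exI[of _ C] conjI C allI impI ballI)
    fix c r p u h ch rh ph uh
    assume A: "c \<in> Hspace \<Omega> 2 \<and> zero_normal_deriv \<Omega> c \<and> r = (\<lambda>x. - wlaplace \<Omega> c x) \<and>
        auxiliary_pair \<Omega> (L20 \<Omega>) (vec_space (H10 \<Omega>)) r p u \<and>
        p \<in> Hspace \<Omega> (rp + 1) \<inter> L20 \<Omega> \<and>
        u \<in> vec_space (Hspace \<Omega> (ru + 1)) \<inter> vec_space (H10 \<Omega>)"
      and h: "h \<in> H"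
      and B: "ch \<in> Lagrange \<Omega> (\<T> h) rc \<and>
        discrete_neg_laplacian \<Omega> (Qh \<Omega> (\<T> h) rp) ch rh \<and>
        auxiliary_pair \<Omega> (Qh \<Omega> (\<T> h) rp) (Uh \<Omega> (\<T> h) ru) rh ph uh"
    let ?Q = "Qh \<Omega> (\<T> h) rp" and ?U = "Uh \<Omega> (\<T> h) ru"
    let ?e = "L2norm ?M (\<lambda>x. p x - ph x) + vHnorm \<Omega> 1 (\<lambda>x. u x - uh x)"
    let ?\<eta> = "L2norm ?M (\<lambda>x. r x - rh x)"
    have Q: "?Q \<subseteq> L20 \<Omega>" and U: "?U \<subseteq> vec_space (H10 \<Omega>)"
      by (auto simp: Qh_def Uh_def vec_space_def)
    \<comment> \<open>The infima need nonempty index sets; the discrete solution itself provides the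
      elements.\<close>
    have ne: "?Q \<noteq> {}" "?U \<noteq> {}"
      using B by (auto simp: auxiliary_pair_def)
    have r: "r \<in> L2 ?M"
      using A L2_cmult[OF wlaplace_L2, of c \<Omega> "- 1"] by simp
    have rh: "rh \<in> L2 ?M"
      using B Q by (auto simp: discrete_neg_laplacian_def intro: L20_L2)
    have "?e \<le> C0 * (L2norm ?M (\<lambda>x. p x - q x) + vHnorm \<Omega> 1 (\<lambda>x. u x - z x) + ?\<eta>)"
      if "q \<in> ?Q" "z \<in> ?U" for q z
      unfolding C0_def using A B K that
      by (intro sum_le_sqrt_mult_sum L2norm_nonneg vHnorm_nonneg
          Galerkin_error_power2[OF op R Q U r rh, folded K_def]) auto
    note best = le_best_approximation[OF ne C0 this]
    have h0: "h > 0" using assms(2) h by (auto simp: mesh_family_def)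
    have \<eta>: "0 \<le> ?\<eta>" by (rule L2norm_nonneg)
    have "0 \<le> best_p \<Omega> ?Q p" unfolding best_p_def by (intro cINF_greatest ne L2norm_nonneg)
    moreover have "0 \<le> best_u \<Omega> ?U u" unfolding best_u_def by (intro cINF_greatest ne vHnorm_nonneg)
    ultimately have "C0 * (best_p \<Omega> ?Q p + best_u \<Omega> ?U u + ?\<eta>) \<le> C * (best_p \<Omega> ?Q p + best_u \<Omega> ?U u + ?\<eta>)"
      using \<eta> by (intro mult_right_mono C0_le) simp
    with best show "?e \<le> C * (best_p \<Omega> ?Q p + best_u \<Omega> ?U u + ?\<eta>)" by linarith
    let ?P = "h ^ (rp + 1) * Hnorm \<Omega> (rp + 1) p" and ?V = "h ^ ru * vHnorm \<Omega> (ru + 1) u"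
    have P: "0 \<le> ?P" and V: "0 \<le> ?V"
      using h0 by (intro mult_nonneg_nonneg Hnorm_nonneg vHnorm_nonneg zero_le_power; simp)+
    have "best_p \<Omega> ?Q p \<le> C1 * ?P" "best_u \<Omega> ?U u \<le> C2 * ?V"
      using bspec[OF bspec[OF C1 h], of p] bspec[OF bspec[OF C2 h], of u] A by (simp_all only: mult.assoc)
    moreover have "C1 * ?P \<le> \<bar>C1\<bar> * ?P" "C2 * ?V \<le> \<bar>C2\<bar> * ?V"
      using P V by (intro mult_right_mono; simp)+
    \<comment> \<open>The cross terms in the expansion of the product of the two sums are
      nonnegative and may be added.\<close>
    moreover have "0 \<le> \<bar>C1\<bar> * ?V" "0 \<le> \<bar>C1\<bar> * ?\<eta>" "0 \<le> \<bar>C2\<bar> * ?P" "0 \<le> \<bar>C2\<bar> * ?\<eta>"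
      by (rule mult_nonneg_nonneg[OF abs_ge_zero V] mult_nonneg_nonneg[OF abs_ge_zero P]
          mult_nonneg_nonneg[OF abs_ge_zero \<eta>])+
    ultimately have "best_p \<Omega> ?Q p + best_u \<Omega> ?U u + ?\<eta> \<le> (1 + \<bar>C1\<bar> + \<bar>C2\<bar>) * (?P + ?V + ?\<eta>)"
      using P V unfolding distrib_right distrib_left mult_1 by linarith
    then have "C0 * (best_p \<Omega> ?Q p + best_u \<Omega> ?U u + ?\<eta>) \<le> C0 * ((1 + \<bar>C1\<bar> + \<bar>C2\<bar>) * (?P + ?V + ?\<eta>))"
      using C0 by (intro mult_left_mono) auto
    with best show "?e \<le> C * (?P + ?V + ?\<eta>)"
      unfolding C_def mult.assoc by linarith
  qed
qed

end
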